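(* Every simplicial $d$-cone $C = \mathbb{R}_+ v_1 + \cdots + \mathbb{R}_+ v_d \subset \mathbb{R}^d$ with $d \geq 2$ has a unimodular triangulation $C = D_1 \cup \cdots \cup D_t$ such that for all $i$ $$\operatorname{Hilb}(D_i) \subset \left( \frac{d^2}{4}\cdot \mu(C) \cdot 4^{\phi(\mu(C))} \cdot \left(\frac{3}{2}\right)^{\frac12 \log_2(\mu(C))\,(\log_2(\mu(C))+3)} \right)\Delta_C.$$
   Context: A simplicial $d$-cone $C\subset\mathbb{R}^d$ is taken to be generated by its extreme integral generators $v_1,\dots,v_d$ (the primitive integral vectors on its extreme rays). The multiplicity $\mu(C)=|\det(v_1,\dots,v_d)|$ is the lattice-normalized volume of $\Delta_C=\operatorname{conv}(0,v_1,\dots,v_d)$; $c\Delta_C$ is the dilation by $c$. A unimodular triangulation is a triangulation of $C$ into simplicial cones of multiplicity $1$. $\operatorname{Hilb}(D)$ is the Hilbert basis of $D\cap\mathbb{Z}^d$ (for unimodular $D$, its extreme integral generators). For a natural number $n=\prod_i p_i^{\alpha_i}$ (prime decomposition), $\eta(n)=\sum_i \alpha_i$ and $\phi(n) = 2(\log_2(n) - \eta(n)) = \sum_i \alpha_i(2\log_2(p_i)-2)$. *)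

theory Defs
  imports "HOL-Analysis.Analysis" "HOL-Computational_Algebra.Primes"
begin

definition lattice_pts :: "(real ^ 'n) set" where
  "lattice_pts = {x. \<forall>i. x $ i \<in> \<int>}"

definition primitive_vec :: "real ^ 'n \<Rightarrow> bool" where
  "primitive_vec x \<longleftrightarrow>
     x \<in> lattice_pts \<and> x \<noteq> 0 \<and>
     (\<forall>(k::nat) y. y \<in> lattice_pts \<and> x = real k *\<^sub>R y \<longrightarrow> k = 1)"

definition nonneg_span :: "('n::finite \<Rightarrow> real ^ 'n) \<Rightarrow> (real ^ 'n) set" where
  "nonneg_span v = {x. \<exists>a. (\<forall>i. 0 \<le> a i) \<and> x = (\<Sum>i\<in>UNIV. a i *\<^sub>R v i)}"

text \<open>
  \<open>simplicial_cone v C\<close>: the set \<open>C\<close> is a (rational) simplicial d-cone, where d is the dimension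
  \<open>CARD('n)\<close> of the ambient space, and \<open>v\<close> lists its extreme integral generators. They are
  determined by \<open>C\<close> up to order, and neither \<open>cone_mult\<close> nor \<open>Delta\<close> depends on the order.
  Injectivity is needed because \<open>independent\<close> speaks about the set \<open>range v\<close>.
\<close>

definition simplicial_cone :: "('n::finite \<Rightarrow> real ^ 'n) \<Rightarrow> (real ^ 'n) set \<Rightarrow> bool" where
  "simplicial_cone v C \<longleftrightarrow>
     (\<forall>i. primitive_vec (v i)) \<and> inj v \<and> independent (range v) \<and> C = nonneg_span v"

text \<open>The determinant of integral vectors is an integer, so the floor does not round (see
  \<open>real_cone_mult\<close>); it only moves the multiplicity to type \<open>nat\<close>.\<close>

definition cone_mult :: "('n::finite \<Rightarrow> real ^ 'n) \<Rightarrow> nat" where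
  "cone_mult v = nat \<lfloor>\<bar>det (\<chi> i. v i)\<bar>\<rfloor>"

lemma real_cone_mult:
  assumes "simplicial_cone v C"
  shows "real (cone_mult v) = \<bar>det (\<chi> i. v i)\<bar>"
proof -
  have "v i $ j \<in> \<int>" for i j
    using assms by (auto simp: simplicial_cone_def primitive_vec_def lattice_pts_def)
  then have "det (\<chi> i. v i) \<in> \<int>"
    unfolding det_def by (auto intro!: Ints_sum Ints_mult Ints_prod)
  then have "\<bar>det (\<chi> i. v i)\<bar> \<in> \<int>"
    by (rule Ints_abs)
  then show ?thesis
    unfolding cone_mult_def by (auto elim!: Ints_cases)
qed

definition Delta :: "('n::finite \<Rightarrow> real ^ 'n) \<Rightarrow> (real ^ 'n) set" where
  "Delta v = convex hull (insert 0 (range v))"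

text \<open>A triangulation is given by its maximal cones: finitely many simplicial d-cones with union
  \<open>C\<close>, any two of which meet in a common face.\<close>

definition cone_triangulation ::
    "(real ^ 'n::finite) set set \<Rightarrow> (real ^ 'n) set \<Rightarrow> bool" where
  "cone_triangulation \<D> C \<longleftrightarrow>
     finite \<D> \<and> (\<forall>D\<in>\<D>. \<exists>w. simplicial_cone w D) \<and> \<Union>\<D> = C \<and>
     (\<forall>D\<in>\<D>. \<forall>E\<in>\<D>. (D \<inter> E) face_of D \<and> (D \<inter> E) face_of E)"

definition unimodular_triangulation ::
    "(real ^ 'n::finite) set set \<Rightarrow> (real ^ 'n) set \<Rightarrow> bool" where
  "unimodular_triangulation \<D> C \<longleftrightarrow>
     cone_triangulation \<D> C \<and> (\<forall>D\<in>\<D>. \<exists>w. simplicial_cone w D \<and> cone_mult w = 1)"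

text \<open>The Hilbert basis of a pointed cone is the set of irreducible elements of its monoid of
  lattice points, which is the unique minimal generating set of this monoid.\<close>

definition Hilb :: "(real ^ 'n) set \<Rightarrow> (real ^ 'n) set" where
  "Hilb D = {x \<in> D \<inter> lattice_pts - {0}.
     \<not> (\<exists>y \<in> D \<inter> lattice_pts - {0}. \<exists>z \<in> D \<inter> lattice_pts - {0}. x = y + z)}"

definition eta :: "nat \<Rightarrow> nat" where
  "eta n = (\<Sum>p\<in>prime_factors n. multiplicity p n)"

definition phi :: "nat \<Rightarrow> real" where
  "phi n = 2 * (log 2 (real n) - real (eta n))"

end

(* Proof idea. Starting from C alone, apply stellar subdivisions until all cones are unimodular.
   A cone of multiplicity > 1 with generators f_1, ..., f_d contains a lattice point
   x = sum (N_j / p) f_j with p prime, where the N_j may be changed modulo p.  Subdividing at x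
   replaces f_i by x and multiplies the multiplicity by N_i / p, while the sum of the lengths of
   the generators (length = sum of the coordinates with respect to v_1, ..., v_d) grows at most by
   the factor 1 + max N_j / p.  The same factors occur in every other cone that contains x.
   It remains to find an additive function pot on the multiplicities that pays for this growth, i.e.
   log_2 (1 + max N_j / p) + pot N_j <= pot p.  For odd p this can fail with N_j = z < p only if z is
   odd and greater than p/2.  Then z = p - w with w even, and one takes N = M p - w for a divisor M
   of w such that p - w/M is divisible by 2, 3 or 5; this works with M < 9 (p/2)^(1/3), because the
   smallest of the largest powers of 2, 3 and 5 that divide w is at most w^(1/3). *)

theory Submission
  imports Defs
begin

section \<open>A potential on the multiplicities\<close>

text \<open>If z is itself a prime just below p, \<open>pot p - pot z\<close> is nearly 0 and cannot
  pay for a growth by almost 2. So N must be composite, but a large N costs growth again. Let l =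
  log_2 p. Splitting a factor 2 off p lowers \<open>quad\<close> by lam * l up to a constant, with
  lam about 0.585. If M is a power of 2 of size about p^s, the growth 1 + M costs s * l and
  \<open>pot M\<close> costs s * lam * l, so s * (1 + lam) < lam is needed. The smaller of two
  coprime prime powers would only give s = 1/2, which fails since 0.79 > 0.585; the smallest of
  three gives s = 1/3, and 0.53 < 0.585. Hence three primes and the cube root. With powers of 3 and
  5, \<open>pot M\<close> costs more, but splitting off 3 or 5 also gains more.\<close>

definition lam :: real where "lam = log 2 3 - 1"

definition quad :: "real \<Rightarrow> real" where "quad l = lam / 2 * l\<^sup>2 + 5 * l - 7"

text \<open>The quadratic term is the one of the exponent in the theorem, split over the prime factors;
  it pays for replacing \<open>p\<close> by a number composed of smaller primes. The linear and the constant
  coefficient are tuned such that the three estimates \<open>cbrt_pot_2\<close>, \<open>cbrt_pot_3\<close>, \<open>cbrt_pot_5\<close>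
  hold.\<close>

definition prime_pot :: "nat \<Rightarrow> real" where
  "prime_pot p = (if p = 2 then lam else quad (log 2 (real p)))"

definition pot :: "nat \<Rightarrow> real" where
  "pot n = sum_mset (image_mset prime_pot (prime_factorization n))"

section \<open>Logarithm estimates and the potential of 2, 3 and 5\<close>

lemma log2_ratio_less:
  fixes x :: real
  assumes "2 ^ m < x ^ k" "x > 0" "k > 0"
  shows "real m / real k < log 2 x"
proof -
  have "real m < log 2 (x ^ k)" using assms by (intro less_log_of_power) auto
  then show ?thesis using assms by (simp add: log_nat_power field_simps)
qed

lemma log2_less_ratio:
  fixes x :: real
  assumes "x ^ k < 2 ^ m" "x > 0" "k > 0"
  shows "log 2 x < real m / real k"
proof -
  have "log 2 (x ^ k) < real m" using assms by (simp add: log_less_iff powr_realpow)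
  then show ?thesis using assms by (simp add: log_nat_power field_simps)
qed

text \<open>19/12 and 65/41 are convergents of the continued fraction of log_2 3.\<close>

lemma lam_bounds: "58 / 100 < lam" "lam < 586 / 1000"
  using log2_ratio_less[of 19 3 12] log2_less_ratio[of 3 41 65] by (simp_all add: lam_def)

lemma log2_5_bounds: "log 2 (5::real) > 232 / 100" "log 2 (5::real) < 233 / 100"
  using log2_ratio_less[of 65 5 28] log2_less_ratio[of 5 31 72] by simp_all

lemma log2_7: "log 2 7 > (279/100::real)"
  using log2_ratio_less[of 14 7 5] by simp

lemma two_powr_lam: "2 powr lam = 3 / 2"
  by (simp add: lam_def powr_diff)

lemma pot_mult: "m > 0 \<Longrightarrow> n > 0 \<Longrightarrow> pot (m * n) = pot m + pot n"
  by (simp add: pot_def prime_factorization_mult)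

lemma pot_1 [simp]: "pot 1 = 0" "pot (Suc 0) = 0"
  by (simp_all add: pot_def)

lemma pot_prime: "prime p \<Longrightarrow> pot p = prime_pot p"
  by (simp add: pot_def prime_factorization_prime)

lemma pot_prime_power: "prime p \<Longrightarrow> pot (p ^ k) = real k * prime_pot p"
  by (simp add: pot_def prime_factorization_prime_power sum_mset_constant)

lemma quad_mono: "0 \<le> x \<Longrightarrow> x \<le> y \<Longrightarrow> quad x \<le> quad y"
  using lam_bounds by (auto simp: quad_def intro!: add_mono mult_left_mono power_mono)

lemma prime_pot_2 [simp]: "prime_pot 2 = lam" by (simp add: prime_pot_def)

lemma real_mult_bounds:
  fixes x y :: real
  assumes "a \<le> x" "x \<le> b" "c \<le> y" "y \<le> d" "0 \<le> a" "0 \<le> c"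
  shows "a * c \<le> x * y" "x * y \<le> b * d"
  using assms by (intro mult_mono; linarith)+

lemma prime_pot_3: "prime_pot 3 \<ge> 1 + lam" "prime_pot 3 \<le> 168 / 100"
proof -
  define k where "k = 1 + lam"
  have e: "2 * prime_pot 3 = lam*(k*k) + 10*k - 14"
    by (simp add: k_def prime_pot_def quad_def lam_def power2_eq_square)
  have l: "58/100 \<le> lam" "lam \<le> 586/1000" using lam_bounds by auto
  have k: "158/100 \<le> k" "k \<le> 1586/1000" using l by (auto simp: k_def)
  have q: "24/10 \<le> k*k" "k*k \<le> 252/100"
    using real_mult_bounds[OF k k] by auto
  have r: "139/100 \<le> lam*(k*k)" "lam*(k*k) \<le> 148/100"
    using real_mult_bounds[OF l q] by auto
  show "prime_pot 3 \<ge> 1 + lam" using r e k unfolding k_def[symmetric] by linarith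
  show "prime_pot 3 \<le> 168/100" using r e k by linarith
qed

lemma prime_pot_5: "prime_pot 5 \<ge> 6" "prime_pot 5 \<le> 625 / 100"
proof -
  have e: "2 * prime_pot 5 = lam*(log 2 5*log 2 5) + 10*log 2 5 - 14"
    by (simp add: prime_pot_def quad_def power2_eq_square)
  have l: "58/100 \<le> lam" "lam \<le> 586/1000" using lam_bounds by auto
  have k: "232/100 \<le> log 2 (5::real)" "log 2 (5::real) \<le> 233/100" using log2_5_bounds by auto
  have q: "538/100 \<le> log 2 5*log 2 (5::real)" "log 2 5*log 2 (5::real) \<le> 543/100"
    using real_mult_bounds[OF k k] by auto
  have r: "312/100 \<le> lam*(log 2 5*log 2 5)" "lam*(log 2 5*log 2 5) \<le> 3183/1000"
    using real_mult_bounds[OF l q] by auto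
  show "prime_pot 5 \<ge> 6" using r e k by linarith
  show "prime_pot 5 \<le> 625 / 100" using r e k by linarith
qed

lemma prime_pot_pos:
  assumes "prime p" shows "prime_pot p > 0"
proof (cases "p = 2")
  case False
  then have "p \<ge> 3" using assms prime_ge_2_nat[of p] by simp
  then have "log 2 3 \<le> log 2 (real p)" by simp
  moreover have "quad (log 2 3) > 0" using prime_pot_3 lam_bounds by (simp add: prime_pot_def)
  ultimately show ?thesis using quad_mono[of "log 2 3"] False by (force simp: prime_pot_def)
qed (use lam_bounds in \<open>simp add: prime_pot_def\<close>)

lemma pot_nonneg: "pot n \<ge> 0"
proof -
  have "(\<Sum>p\<in>#prime_factorization n. 0) \<le> pot n"
    unfolding pot_def
    by (rule sum_mset_mono) (auto dest!: in_prime_factors_imp_prime prime_pot_pos)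
  then show ?thesis by simp
qed

text \<open>The surplus \<open>lam * x * y + 7\<close> is the reason for the quadratic form: a
  product has a smaller potential than a prime of its size, and the difference pays for the
  growth.\<close>

lemma quad_add: "quad (x + y) = quad x + quad y + lam * x * y + 7"
  by (simp add: quad_def power2_eq_square algebra_simps add_divide_distrib)

lemma nat_prime_induct [consumes 1, case_names one mult]:
  assumes "(n::nat) > 0" "P 1" "\<And>p m. prime p \<Longrightarrow> m > 0 \<Longrightarrow> P m \<Longrightarrow> P (p * m)"
  shows "P n"
  using assms(1)
proof (induction n rule: less_induct)
  case (less n)
  show ?case
  proof (cases "n = 1")
    case False
    then obtain p where p: "prime p" "p dvd n" using prime_factor_nat by blast
    then obtain m where m: "n = p * m" by blast
    have "m > 0" "m < n" using less.prems m prime_gt_1_nat[OF p(1)] by auto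
    then show ?thesis using less.IH[of m] assms(3)[OF p(1)] m by simp
  qed (use assms in auto)
qed

text \<open>Powers of two have to be bounded separately: \<open>quad\<close> is negative at \<open>0\<close> and at \<open>1\<close>.\<close>

definition potb :: "real \<Rightarrow> real" where "potb l = max (lam * l) (quad l)"

lemma potb_mono: "0 \<le> x \<Longrightarrow> x \<le> y \<Longrightarrow> potb x \<le> potb y"
  using lam_bounds unfolding potb_def by (intro max.mono mult_left_mono quad_mono) auto

text \<open>Induction over the prime factors: \<open>quad\<close> is superadditive on nonnegative
  arguments, and a power of two costs only lam per doubling, less than the linear coefficient
  5.\<close>

lemma pot_le:
  assumes "n > 0" shows "pot n \<le> potb (log 2 (real n))"
  using assms
proof (induction n rule: nat_prime_induct)
  case one
  then show ?case by (simp add: potb_def)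
next
  case (mult p m)
  define l k where "l = log 2 (real p)" and "k = log 2 (real m)"
  have lk: "log 2 (real (p * m)) = l + k"
    using mult by (simp add: l_def k_def log_mult prime_gt_0_nat)
  have k: "k \<ge> 0" using mult by (simp add: k_def)
  have l: "l \<ge> 0" using prime_gt_0_nat[OF mult(1)] by (simp add: l_def)
  have pm: "pot (p * m) = prime_pot p + pot m"
    using mult by (simp add: pot_mult pot_prime prime_gt_0_nat)
  have kk: "lam * k * k \<ge> 0" "lam * l * k \<ge> 0" using lam_bounds k l by auto
  have lamk: "lam * k \<ge> 0" using lam_bounds k by (intro mult_nonneg_nonneg) auto
  have lk5: "lam * k \<le> 5 * k" using lam_bounds k by (intro mult_right_mono) auto
  have IH: "pot m \<le> lam * k \<or> pot m \<le> quad k"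
    using mult.IH by (simp add: potb_def k_def le_max_iff_disj)
  have "prime_pot p + pot m \<le> potb (l + k)"
  proof (cases "p = 2")
    case True
    then have "l = 1" by (simp add: l_def)
    moreover have "lam + quad k \<le> quad (1 + k)"
      using quad_add[of 1 k] lam_bounds lamk by (simp add: quad_def[of 1])
    moreover have "lam + lam * k = lam * (1 + k)" by (simp add: algebra_simps)
    ultimately show ?thesis using IH True by (auto simp: potb_def le_max_iff_disj)
  next
    case False
    then have "prime_pot p = quad l" by (simp add: prime_pot_def l_def)
    moreover have "quad l + lam * k \<le> quad (l + k)"
      using kk lk5 by (simp add: quad_def power2_eq_square algebra_simps add_divide_distrib)
    moreover have "quad l + quad k \<le> quad (l + k)" using kk by (simp add: quad_add)
    ultimately show ?thesis using IH by (auto simp: potb_def le_max_iff_disj)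
  qed
  then show ?case using pm lk by simp
qed


text \<open>\<open>2 powr cbrt_pot (log 2 p)\<close> is \<open>9 * (p/2) powr (1/3)\<close>, the bound for \<open>1 + M\<close>.\<close>

definition cbrt_pot :: "real \<Rightarrow> real" where
  "cbrt_pot l = 2 * (1 + lam) + (l - 1) / 3"

lemma le_potb_iff: "x + potb l \<le> y \<longleftrightarrow> x + lam * l \<le> y \<and> x + quad l \<le> y"
  by (auto simp: potb_def max_def)

text \<open>The potential condition of \<open>admissible_multiple\<close> for r = 2 and M = 2^e,
  where l = log_2 p with p >= 7. The second alternative on e says M^3 <= p/2. The case e = 0 also
  settles the choice N = z.\<close>

lemma cbrt_pot_2:
  fixes l e :: real
  assumes l: "279 / 100 \<le> l" and e: "0 \<le> e" "e \<le> 2 \<or> 3 * e \<le> l - 1"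
  shows "cbrt_pot l + (e + 1) * lam + potb (l - 1) \<le> quad l"
proof -
  define m where "m = l - 1"
  have m: "179 / 100 \<le> m" and lm: "l = m + 1" using l by (auto simp: m_def)
  have q: "quad l = quad m + lam * m + lam / 2 + 5"
    using quad_add[of m 1] by (simp add: lm quad_def[of 1])
  have lm1: "58 / 100 * m \<le> lam * m" using lam_bounds m by (intro mult_right_mono) auto
  have lm2: "lam * m \<le> 586 / 1000 * m" using lam_bounds m by (intro mult_right_mono) auto
  have mm: "179 / 100 * m \<le> m * m" using m by (intro mult_right_mono) auto
  have "58 / 100 * (m * m) \<le> lam * (m * m)" using lam_bounds m by (intro mult_right_mono) auto
  then have qm: "quad m \<ge> 5 * m - 7" using mm m by (simp add: quad_def power2_eq_square)
  have "lam * e \<le> lam * 2 \<or> lam * (3 * e) \<le> lam * m"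
    using e lam_bounds mult_left_mono[of e 2 lam] mult_left_mono[of "3 * e" m lam] by (auto simp: m_def)
  then have "lam * e \<le> 2 * lam \<or> 3 * (lam * e) \<le> lam * m" by (auto simp: algebra_simps)
  moreover have "(e + 1) * lam = lam * e + lam" by (simp add: algebra_simps)
  ultimately show ?thesis
    using q lm1 lm2 qm lam_bounds m unfolding le_potb_iff cbrt_pot_def m_def[symmetric]
    by - (elim disjE; intro conjI; argo)
qed

text \<open>The same condition for r = 3 and M = 2^i * 3^e with i <= 1; the summand
  \<open>lam\<close> pays for 2^i.\<close>

lemma cbrt_pot_3:
  fixes l e :: real
  assumes l: "279 / 100 \<le> l" and e: "0 \<le> e" "3 * e * (1 + lam) \<le> l - 1"
  shows "cbrt_pot l + lam + (e + 1) * prime_pot 3 + potb (l - (1 + lam)) \<le> quad l"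
proof -
  define k where "k = l - (1 + lam)"
  have k: "120 / 100 \<le> k" and lk: "l = k + (1 + lam)" using l lam_bounds by (auto simp: k_def)
  have q: "quad l = quad k + prime_pot 3 + lam * ((1 + lam) * k) + 7"
    using quad_add[of k "1 + lam"] by (simp add: lk prime_pot_def lam_def)
  have "158 / 100 * k \<le> (1 + lam) * k" using lam_bounds k by (intro mult_right_mono) auto
  then have "58 / 100 * (158 / 100 * k) \<le> lam * ((1 + lam) * k)"
    using lam_bounds k by (intro mult_mono) auto
  then have lk1: "916 / 1000 * k \<le> lam * ((1 + lam) * k)" using k by linarith
  have lk2: "lam * k \<le> 586 / 1000 * k" using lam_bounds k by (intro mult_right_mono) auto
  have "0 \<le> lam * (k * k)" using lam_bounds k by (intro mult_nonneg_nonneg) auto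
  then have qk: "quad k \<ge> 5 * k - 7" using k by (simp add: quad_def power2_eq_square)
  have "e * (158 / 100) \<le> e * (1 + lam)" using lam_bounds e by (intro mult_left_mono) auto
  then have "474 / 100 * e \<le> k + lam" using e by (simp add: lk)
  moreover have "e * prime_pot 3 \<le> 168 / 100 * e"
    using prime_pot_3 e mult_left_mono[of "prime_pot 3" "168/100" e] by simp
  ultimately show ?thesis
    using q lk1 lk2 qk lam_bounds k prime_pot_3
    unfolding le_potb_iff cbrt_pot_def k_def[symmetric] unfolding lk distrib_right[of e] mult_1 by - (intro conjI; argo)
qed

text \<open>The same condition for r = 5 and M = 2^i * 5^e with i <= 3. It is used only if 8 divides
  w, and then p > 2 * w >= 16.\<close>

lemma cbrt_pot_5:
  fixes l e :: real
  assumes l: "4 \<le> l" and e: "0 \<le> e" "3 * e * log 2 5 \<le> l - 1"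
  shows "cbrt_pot l + 3 * lam + (e + 1) * prime_pot 5 + potb (l - log 2 5) \<le> quad l"
proof -
  define b where "b = log 2 (5::real)"
  have b: "232 / 100 < b" "b < 233 / 100" using log2_5_bounds by (auto simp: b_def)
  define k where "k = l - b"
  have k: "167 / 100 \<le> k" and lk: "l = k + b" using l b by (auto simp: k_def)
  have q: "quad l = quad k + prime_pot 5 + lam * (b * k) + 7"
    using quad_add[of k b] by (simp add: lk prime_pot_def b_def)
  have "232 / 100 * k \<le> b * k" using b k by (intro mult_right_mono) auto
  then have "58 / 100 * (232 / 100 * k) \<le> lam * (b * k)"
    using lam_bounds k by (intro mult_mono) auto
  then have lk1: "1345 / 1000 * k \<le> lam * (b * k)" using k by linarith
  have lk2: "lam * k \<le> 586 / 1000 * k" using lam_bounds k by (intro mult_right_mono) auto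
  have "0 \<le> lam * (k * k)" using lam_bounds k by (intro mult_nonneg_nonneg) auto
  then have qk: "quad k \<ge> 5 * k - 7" using k by (simp add: quad_def power2_eq_square)
  have "e * (232 / 100) \<le> e * b" using b e by (intro mult_left_mono) auto
  then have "696 / 100 * e \<le> k + b - 1" using e by (simp add: lk b_def)
  moreover have "e * prime_pot 5 \<le> 625 / 100 * e"
    using prime_pot_5 e mult_left_mono[of "prime_pot 5" "625/100" e] by simp
  ultimately show ?thesis
    using q lk1 lk2 qk lam_bounds k b prime_pot_5
    unfolding le_potb_iff cbrt_pot_def b_def[symmetric] k_def[symmetric]
    unfolding lk distrib_right[of e] mult_1 by - (intro conjI; argo)
qed

section \<open>Representatives of residues modulo p that the potential can pay for\<close>

definition admissible :: "nat \<Rightarrow> real \<Rightarrow> nat \<Rightarrow> bool" where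
  "admissible p T z \<longleftrightarrow> (\<exists>N>0. N mod p = z \<and> 1 + real N / real p \<le> 2 powr T \<and> T + pot N \<le> prime_pot p)"

lemma pot_le_log:
  assumes "q > 0" "log 2 (real q) \<le> y" shows "pot q \<le> potb y"
proof -
  have "0 \<le> log 2 (real q)" using assms by simp
  then show ?thesis using pot_le[OF assms(1)] potb_mono assms by (meson order_trans)
qed

text \<open>With u = w / M, the number N = M * p - w = M * (p - u) factors as M * r * q with q <= p
  / r. So M and r are counted exactly, and only q needs the general bound
  \<open>potb\<close>.\<close>

lemma admissible_multiple:
  fixes p w M r R :: nat and T :: real
  assumes p: "p > 0" "0 < w" "w < p" and M: "M dvd w" "prime r" "r dvd p - w div M"
    and R: "1 + real M \<le> 2 powr T"
    and pot: "T + pot M + prime_pot r + potb (log 2 p - log 2 r) \<le> prime_pot p"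
  shows "admissible p T (p - w)"
proof -
  obtain u where u: "w = M * u" using M by blast
  have M0: "M > 0" and u0: "u > 0" using p u by auto
  have wu: "w div M = u" using u M0 by simp
  have up: "u < p" using p u M0 by (metis le_less_trans dvd_imp_le dvd_triv_right)
  obtain q where q: "p - u = r * q" using M wu by auto
  have q0: "q > 0" using q up by (cases q) auto
  have r0: "r > 0" using M(2) prime_gt_0_nat by blast
  define N where "N = M * (p - u)"
  have N0: "N > 0" using M0 up by (simp add: N_def)
  have "N + w = M * p" using up u by (simp add: N_def diff_mult_distrib2 add.commute)
  then have "N mod p = p - w"
  proof -
    have "N = (M - 1) * p + (p - w)"
      using \<open>N + w = M * p\<close> M0 p by (cases M) auto
    then show ?thesis using p mod_mult_self4[of "M - 1" p "p - w"] by (metis diff_less mod_less mod_mult_self3)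
  qed
  moreover have "real N / real p \<le> real M"
  proof -
    have "N \<le> M * p" by (simp add: N_def)
    then have "real N \<le> real M * real p" by (metis of_nat_le_iff of_nat_mult)
    then show ?thesis using p by (simp add: divide_le_eq)
  qed
  moreover have "pot N = pot M + (prime_pot r + pot q)"
    using M0 q0 r0 M by (simp add: N_def q pot_mult pot_prime)
  moreover have "pot q \<le> potb (log 2 p - log 2 r)"
  proof (rule pot_le_log[OF q0])
    have "r * q \<le> p" using q by linarith
    then have "real r * real q \<le> real p" by (metis of_nat_le_iff of_nat_mult)
    then have "log 2 (real r * real q) \<le> log 2 (real p)" using r0 q0 p by simp
    then show "log 2 q \<le> log 2 p - log 2 r" using r0 q0 by (simp add: log_mult)
  qed
  ultimately show ?thesis using N0 R pot unfolding admissible_def by (intro exI[of _ N]) auto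
qed

text \<open>R is a prime power (or 1) with R^3 <= p/2, and M is at most 8 * R in all applications;
  thus 1 + M <= 9 * R. The factor 9 accounts for \<open>2 * (1 + lam)\<close>, as 2 powr (1 + lam) =
  3.\<close>

lemma cbrt_bound:
  fixes p R M :: nat
  assumes "p > 0" "R > 0" "3 * log 2 R \<le> log 2 p - 1" "M < 9 * R"
  shows "1 + real M \<le> 2 powr cbrt_pot (log 2 p)"
proof -
  have "1 + real M \<le> 9 * real R" using assms(4) by linarith
  also have "\<dots> = 2 powr (log 2 (9 * real R))" using assms by simp
  also have "log 2 (9 * real R) = 2 * (1 + lam) + log 2 R"
    using assms log_nat_power[of 3 2 2] by (simp add: log_mult lam_def)
  also have "2 powr \<dots> \<le> 2 powr cbrt_pot (log 2 p)"
    using assms by (intro powr_mono) (auto simp: cbrt_pot_def)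
  finally show ?thesis .
qed

lemma admissible_self:
  assumes "0 < z" "z < p" "1 \<le> T" "T + pot z \<le> prime_pot p"
  shows "admissible p T z"
proof -
  have "1 + real z / real p \<le> 2 powr 1" using assms by simp
  also have "\<dots> \<le> 2 powr T" using assms by (intro powr_mono) auto
  finally show ?thesis using assms unfolding admissible_def by (intro exI[of _ z]) auto
qed

lemma nat_power_decomp:
  fixes w r :: nat
  assumes "w > 0" "r > 1"
  shows "\<exists>e u. w = r ^ e * u \<and> \<not> r dvd u"
  using multiplicity_decompose'[of w r] assms by (metis less_irrefl nat_dvd_1_iff_1)

text \<open>The powers are pairwise coprime, so their product divides w and is at most w; hence
  their cubes cannot all exceed w.\<close>

lemma one_of_three_powers_small:
  fixes w :: nat
  assumes "w > 0" "2 ^ b dvd w" "3 ^ c dvd w" "5 ^ d dvd w"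
  shows "(2 ^ b) ^ 3 \<le> w \<or> (3 ^ c) ^ 3 \<le> w \<or> (5 ^ d) ^ 3 \<le> w"
proof (rule ccontr)
  assume a: "\<not> ?thesis"
  have "coprime (2 ^ b) (3 ^ c :: nat)" "coprime (2 ^ b * 3 ^ c) (5 ^ d :: nat)"
    by (auto simp: coprime_mult_left_iff intro!: coprime_power_left_iff[THEN iffD2]
        coprime_power_right_iff[THEN iffD2] primes_coprime)
  then have "2 ^ b * 3 ^ c * 5 ^ d dvd w" using assms by (intro divides_mult) auto
  then have "2 ^ b * 3 ^ c * 5 ^ d \<le> w" using assms by (intro dvd_imp_le) auto
  then have "(2 ^ b * 3 ^ c * 5 ^ d) ^ 3 \<le> w ^ 3" by (intro power_mono) auto
  moreover have "w * w * w < (2 ^ b) ^ 3 * (3 ^ c) ^ 3 * (5 ^ d) ^ 3"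
    using a assms by (intro mult_strict_mono mult_pos_pos) auto
  ultimately show False by (simp add: power_mult_distrib power3_eq_cube mult_ac)
qed

lemma log_power_cube:
  fixes w e r p :: nat
  assumes "(r ^ e) ^ 3 \<le> w" "2 * w < p" "r > 0"
  shows "3 * real e * log 2 (real r) \<le> log 2 (real p) - 1"
proof -
  have w: "w > 0" using assms by (metis gr0I le_zero_eq power_eq_0_iff not_less_zero zero_less_iff_neq_zero)
  have "log 2 (real ((r ^ e) ^ 3)) \<le> log 2 (real w)"
    using assms w by (subst log_le_cancel_iff) (auto simp del: of_nat_power)
  moreover have "log 2 (real ((r ^ e) ^ 3)) = 3 * real e * log 2 (real r)"
    using assms by (simp add: log_nat_power power_mult[symmetric])
  moreover have "log 2 (2 * real w) \<le> log 2 (real p)" using assms w by simp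
  then have "log 2 (real w) \<le> log 2 (real p) - 1" using w by (simp add: log_mult)
  ultimately show ?thesis by simp
qed

text \<open>2 is a primitive root modulo 3, so one of u and 2u is congruent to p.\<close>

lemma dvd_pow2_mult_diff_3:
  fixes p u :: nat
  assumes "\<not> 3 dvd p" "\<not> 3 dvd u" "2 * u < p"
  shows "3 dvd p - u \<or> 3 dvd p - 2 * u"
  using assms by presburger

text \<open>2 is also a primitive root modulo 5, but all of 1, 2, 4, 8 are needed to reach every
  unit.\<close>

lemma dvd_pow2_mult_diff_5:
  fixes p u :: nat
  assumes "\<not> 5 dvd p" "\<not> 5 dvd u" "8 * u < p"
  shows "5 dvd p - u \<or> 5 dvd p - 2 * u \<or> 5 dvd p - 4 * u \<or> 5 dvd p - 8 * u"
  using assms by presburger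

lemma pot_pow2: "pot (2 ^ i) = real i * lam"
  by (simp add: pot_prime_power)

lemma pot_pow2_mult: "prime r \<Longrightarrow> pot (2 ^ i * r ^ e) = real i * lam + real e * prime_pot r"
  by (simp add: pot_mult pot_prime_power prime_gt_0_nat)

lemma admissible_large:
  assumes p: "prime p" "p \<ge> 7" and z: "0 < z" "z < p"
  shows "admissible p (cbrt_pot (log 2 p)) z"
proof -
  define l where "l = log 2 (real p)"
  have "log 2 7 \<le> l" using p by (simp add: l_def)
  then have l: "279 / 100 \<le> l" using log2_7 by linarith
  have potp: "prime_pot p = quad l" using p by (simp add: prime_pot_def l_def)
  have T1: "1 \<le> cbrt_pot l" using l lam_bounds by (simp add: cbrt_pot_def)
  have step0: "cbrt_pot l + lam + potb (l - 1) \<le> quad l"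
    using cbrt_pot_2[OF l, of 0] by simp
  have half: "pot u \<le> potb (l - 1)" if "u > 0" "2 * u \<le> p" for u
  proof (rule pot_le_log[OF that(1)])
    have "log 2 (2 * real u) \<le> log 2 (real p)" using that by simp
    then show "log 2 (real u) \<le> l - 1" using that by (simp add: l_def log_mult)
  qed
  have oddp: "odd p" using p prime_odd_nat by auto
  show ?thesis unfolding l_def[symmetric]
  \<comment> \<open>Here z or z / 2 is at most p / 2. This factor 2 already pays for the growth with
    N = z.\<close>
  proof (cases "2 * z \<le> p \<or> even z")
    case True
    have "pot z \<le> lam + potb (l - 1)"
    proof (cases "2 * z \<le> p")
      case True
      then show ?thesis using half[of z] z lam_bounds by linarith
    next
      case False
      then obtain u where u: "z = 2 * u" using \<open>2 * z \<le> p \<or> even z\<close> by auto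
      then have "pot z = lam + pot u" using z by (simp add: pot_mult pot_prime)
      then show ?thesis using half[of u] u z by simp
    qed
    then show "admissible p (cbrt_pot l) z"
      using z T1 step0 potp by (intro admissible_self) auto
  next
    case False
    define w where "w = p - z"
    have w: "w > 0" "w < p" "2 * w < p" "even w" "z = p - w"
      using False z oddp by (auto simp: w_def)
    have ndvd: "\<not> r dvd p" if "1 < r" "r < 7" for r
      using p that by (metis leD prime_nat_iff order_less_irrefl)
    obtain b u2 where b: "w = 2 ^ b * u2" "\<not> 2 dvd u2"
      using nat_power_decomp[OF w(1), of 2] by auto
    obtain c u3 where c: "w = 3 ^ c * u3" "\<not> 3 dvd u3"
      using nat_power_decomp[OF w(1), of 3] by auto
    obtain d u5 where d: "w = 5 ^ d * u5" "\<not> 5 dvd u5"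
      using nat_power_decomp[OF w(1), of 5] by auto
    have cube: "(2 ^ b) ^ 3 \<le> w \<or> (3 ^ c) ^ 3 \<le> w \<or> (5 ^ d) ^ 3 \<le> w"
      by (rule one_of_three_powers_small[OF w(1)]) (use b c d in \<open>metis dvd_triv_left\<close>)+
    have b0: "b > 0" using b w by (cases b) auto
    \<comment> \<open>The powers 2 and 4 are small enough for M even if they exceed the cube root.
      Treating them first leaves 8 dvd w in the last case, which provides the multipliers 1, 2, 4, 8
      modulo 5.\<close>
    consider (two) "b \<le> 2 \<or> (2 ^ b) ^ 3 \<le> w" | (three) "(3 ^ c) ^ 3 \<le> w"
      | (five) "(5 ^ d) ^ 3 \<le> w" "b \<ge> 3"
      using cube by linarith
    then have "admissible p (cbrt_pot l) (p - w)"
    proof cases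
      case two
      show ?thesis
      proof (rule admissible_multiple[where M = "2 ^ b" and r = 2])
        have "w div 2 ^ b = u2" by (simp add: b)
        moreover have "even (p - u2)" using oddp b by simp
        ultimately show "2 dvd p - w div 2 ^ b" by simp
        have e: "real b \<le> 2 \<or> 3 * real b \<le> l - 1"
          using two log_power_cube[of 2 b w p] w by (auto simp: l_def)
        show "1 + real (2 ^ b) \<le> 2 powr cbrt_pot l"
        proof (cases "b \<le> 2")
          case True
          then have "(2::nat) ^ b \<le> 2 ^ 2" by (intro power_increasing) auto
          then show ?thesis using cbrt_bound[of p 1 "2 ^ b"] p l by (simp add: l_def)
        next
          case False
          then show ?thesis using cbrt_bound[of p "2 ^ b" "2 ^ b"] p two e
            by (simp add: l_def log_nat_power)
        qed
        show "cbrt_pot l + pot (2 ^ b) + prime_pot 2 + potb (log 2 (real p) - log 2 (real 2)) \<le> prime_pot p"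
          using cbrt_pot_2[OF l _ e] potp by (simp add: pot_pow2 l_def algebra_simps)
      qed (use w p b in auto)
    next
      case three
      have e: "3 * real c * (1 + lam) \<le> l - 1"
        using log_power_cube[OF three, of p] w by (simp add: l_def lam_def)
      obtain v where v: "u3 = 2 * v" using c w by auto
      have "2 * v < p" using w c v by (metis dvd_imp_le dvd_triv_right le_less_trans)
      then have "3 dvd p - v \<or> 3 dvd p - 2 * v"
        using c v ndvd[of 3] by (intro dvd_pow2_mult_diff_3) auto
      \<comment> \<open>The factor 2 of w / 3^c is moved into M (i = 1) or left in w / M (i = 0),
        whichever makes p - w / M divisible by 3.\<close>
      then have "\<exists>i\<le>1. 3 dvd p - 2 ^ (1 - i) * v"
        by (metis diff_zero diff_self_eq_0 le_refl mult_1 power_0 power_one_right zero_le)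
      then obtain i where i0: "i \<le> 1" "3 dvd p - 2 ^ (1 - i) * v" by blast
      have "(2::nat) ^ i * 2 ^ (1 - i) = 2 ^ 1" using i0 by (simp flip: power_add)
      then have "2 ^ i * 3 ^ c * (2 ^ (1 - i) * v) = 2 ^ 1 * (3 ^ c * v)"
        by (metis (no_types, lifting) mult.assoc mult.left_commute)
      then have wi: "w = 2 ^ i * 3 ^ c * (2 ^ (1 - i) * v)" using c v by simp
      have dv: "2 ^ i * 3 ^ c dvd w" unfolding wi by (rule dvd_triv_left)
      have "w div (2 ^ i * 3 ^ c) = 2 ^ (1 - i) * v"
        unfolding wi by (rule nonzero_mult_div_cancel_left) simp
      then have i: "i \<le> 1" "3 dvd p - w div (2 ^ i * 3 ^ c)" "2 ^ i * 3 ^ c dvd w"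
        using i0 dv by auto
      have i': "(2::nat) ^ i \<le> 2 ^ 1" using i by (intro power_increasing) auto
      show ?thesis
      proof (rule admissible_multiple[where M = "2 ^ i * 3 ^ c" and r = 3])
        have "2 ^ i * 3 ^ c < (9::nat) * 3 ^ c" using i' by simp
        then show "1 + real (2 ^ i * 3 ^ c) \<le> 2 powr cbrt_pot l"
          using e p unfolding l_def by (intro cbrt_bound[of p "3 ^ c"]) (auto simp: log_nat_power lam_def)
        have "real i * lam \<le> 1 * lam" using i lam_bounds by (intro mult_right_mono) auto
        then show "cbrt_pot l + pot (2 ^ i * 3 ^ c) + prime_pot 3 + potb (log 2 (real p) - log 2 (real 3)) \<le> prime_pot p"
          using cbrt_pot_3[OF l _ e] potp by (simp add: pot_pow2_mult l_def lam_def algebra_simps)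
      qed (use w p i in auto)
    next
      case five
      have e: "3 * real d * log 2 5 \<le> l - 1"
        using log_power_cube[OF five(1), of p] w by (simp add: l_def)
      have "coprime (2 ^ 3) (5 ^ d :: nat)"
        by (intro coprime_power_left_iff[THEN iffD2] coprime_power_right_iff[THEN iffD2] disjI1
            primes_coprime) auto
      moreover have "(2::nat) ^ 3 dvd w" using five b by (metis le_imp_power_dvd dvd_mult2)
      ultimately have "(2::nat) ^ 3 dvd u5" using d by (metis coprime_dvd_mult_right_iff)
      then obtain v where v: "u5 = 8 * v" by auto
      have "8 * v < p" using w d v by (metis dvd_imp_le dvd_triv_right le_less_trans)
      then have "5 dvd p - v \<or> 5 dvd p - 2 * v \<or> 5 dvd p - 4 * v \<or> 5 dvd p - 8 * v"
        using d v ndvd[of 5] by (intro dvd_pow2_mult_diff_5) auto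
      then have "\<exists>i\<le>3. 5 dvd p - 2 ^ (3 - i) * v"
        by (elim disjE) (rule exI[of _ 3] exI[of _ 2] exI[of _ 1] exI[of _ 0], simp; fail)+
      then obtain i where i0: "i \<le> 3" "5 dvd p - 2 ^ (3 - i) * v" by blast
      have "(2::nat) ^ i * 2 ^ (3 - i) = 2 ^ 3" using i0 by (simp flip: power_add)
      then have "2 ^ i * 5 ^ d * (2 ^ (3 - i) * v) = 2 ^ 3 * (5 ^ d * v)"
        by (metis (no_types, lifting) mult.assoc mult.left_commute)
      then have wi: "w = 2 ^ i * 5 ^ d * (2 ^ (3 - i) * v)" using d v by simp
      have dv: "2 ^ i * 5 ^ d dvd w" unfolding wi by (rule dvd_triv_left)
      have "w div (2 ^ i * 5 ^ d) = 2 ^ (3 - i) * v"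
        unfolding wi by (rule nonzero_mult_div_cancel_left) simp
      then have i: "i \<le> 3" "5 dvd p - w div (2 ^ i * 5 ^ d)" "2 ^ i * 5 ^ d dvd w"
        using i0 dv by auto
      have i': "(2::nat) ^ i \<le> 2 ^ 3" using i by (intro power_increasing) auto
      have "8 \<le> w" using \<open>2 ^ 3 dvd w\<close> w by (simp add: dvd_imp_le)
      then have "log 2 (2 ^ 4) \<le> l" unfolding l_def using w by (subst log_le_cancel_iff) auto
      moreover have "log 2 (2 ^ 4 :: real) = 4" by (subst log_nat_power) auto
      ultimately have l4: "4 \<le> l" by simp
      show ?thesis
      proof (rule admissible_multiple[where M = "2 ^ i * 5 ^ d" and r = 5])
        have "2 ^ i * 5 ^ d < (9::nat) * 5 ^ d" using i' by simp
        then show "1 + real (2 ^ i * 5 ^ d) \<le> 2 powr cbrt_pot l"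
          using e p unfolding l_def by (intro cbrt_bound[of p "5 ^ d"]) (auto simp: log_nat_power)
        have "real i * lam \<le> 3 * lam" using i lam_bounds by (intro mult_right_mono) auto
        then show "cbrt_pot l + pot (2 ^ i * 5 ^ d) + prime_pot 5 + potb (log 2 (real p) - log 2 (real 5)) \<le> prime_pot p"
          using cbrt_pot_5[OF l4 _ e] potp by (simp add: pot_pow2_mult l_def algebra_simps)
      qed (use w p i in auto)
    qed
    then show "admissible p (cbrt_pot l) z" using w by simp
  qed
qed

text \<open>One T must serve all residues: the length grows with the largest coefficient of x, while
  the potential of a new cone changes by the coefficient of the replaced generator alone. The lower
  bound lam on T is for termination.\<close>

lemma admissible_exists:
  assumes p: "prime p"
  shows "\<exists>T\<ge>lam. \<forall>z. 0 < z \<and> z < p \<longrightarrow> admissible p T z"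
proof -
  consider "p = 2" | "p = 3" | "p = 5" | "p \<ge> 7"
  proof -
    have "p \<noteq> 4" "p \<noteq> 6" using p by (auto simp: prime_nat_numeral_eq)
    then show ?thesis using that prime_ge_2_nat[OF p] by linarith
  qed
  then show ?thesis
  proof cases
    case 1
    \<comment> \<open>The origin of lam and of the base 3/2: all nonzero coefficients are 1/2, and
      the growth is 1 + 1/2.\<close>
    have "admissible 2 lam 1" unfolding admissible_def
      by (intro exI[of _ 1]) (simp add: two_powr_lam)
    then have "admissible p lam z" if "0 < z" "z < p" for z
      using that 1 by (cases "z = 1") auto
    then show ?thesis by blast
  next
    case 2
    have "admissible p 1 z" if "0 < z" "z < p" for z
    proof (rule admissible_self[OF that])
      have "z = 1 \<or> z = 2" using that 2 by auto
      then show "1 + pot z \<le> prime_pot p" using 2 prime_pot_3 lam_bounds by (auto simp: pot_prime)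
    qed simp
    then show ?thesis using lam_bounds by (intro exI[of _ 1]) auto
  next
    case 3
    have "admissible p 1 z" if "0 < z" "z < p" for z
    proof (rule admissible_self[OF that])
      have "z = 1 \<or> z = 2 \<or> z = 3 \<or> z = 2 ^ 2" using that 3 by auto
      then show "1 + pot z \<le> prime_pot p" using 3 prime_pot_3 prime_pot_5 lam_bounds
        by (auto simp: pot_prime pot_pow2 simp del: power2_eq_square power_numeral)
    qed simp
    then show ?thesis using lam_bounds by (intro exI[of _ 1]) auto
  next
    case 4
    have "cbrt_pot (log 2 p) \<ge> lam"
    proof -
      have "log 2 7 \<le> log 2 (real p)" using 4 by simp
      then show ?thesis using log2_7 lam_bounds by (simp add: cbrt_pot_def)
    qed
    then show ?thesis using admissible_large[OF p 4] by blast
  qed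
qed

text \<open>The right-hand side is the exponent in \<open>bound_eq_powr\<close>. It grows with a
  further prime by that prime's own share and a nonnegative cross term of the square. The extra 1
  for n > 1 later halves the factor d.\<close>

lemma pot_le_budget:
  assumes "n > 0"
  shows "pot n + (if n = 1 then 0 else 1) \<le>
    5 * log 2 (real n) - 4 * real (eta n) + lam / 2 * (log 2 (real n) * (log 2 (real n) + 3))"
  using assms
proof (induction n rule: nat_prime_induct)
  case one
  then show ?case by (simp add: eta_def)
next
  case (mult p m)
  define l k where "l = log 2 (real p)" and "k = log 2 (real m)"
  have p0: "p > 0" using mult(1) prime_gt_0_nat by blast
  have lk: "log 2 (real (p * m)) = l + k"
    using mult p0 by (simp add: l_def k_def log_mult)
  have pm: "pot (p * m) = prime_pot p + pot m"
    using mult by (simp add: pot_mult pot_prime p0)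
  have eta: "eta (p * m) = 1 + eta m"
  proof -
    have "eta n = size (prime_factorization n)" for n
      unfolding eta_def size_multiset_overloaded_eq
      by (intro sum.cong) (auto simp: count_prime_factorization dest: in_prime_factors_imp_prime)
    then show ?thesis using mult p0 by (simp add: prime_factorization_mult prime_factorization_prime)
  qed
  have "k \<ge> 0" "l \<ge> 1" using mult prime_ge_2_nat[OF mult(1)] by (auto simp: k_def l_def le_log_iff)
  then have kl: "0 \<le> lam * (k * l)" "lam * l \<ge> lam * 1" using lam_bounds by (auto intro: mult_left_mono)
  have "prime_pot p + 1 \<le> 5 * l - 4 + lam / 2 * (l * (l + 3))"
  proof (cases "p = 2")
    case True
    then show ?thesis using lam_bounds by (simp add: l_def)
  next
    case False
    then have "prime_pot p = lam / 2 * (l * l) + 5 * l - 7"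
      by (simp add: prime_pot_def quad_def l_def power2_eq_square)
    moreover have "lam / 2 * (l * (l + 3)) = lam / 2 * (l * l) + 3 / 2 * (lam * l)"
      by (simp add: algebra_simps)
    ultimately show ?thesis using kl lam_bounds by argo
  qed
  moreover have "lam / 2 * ((l + k) * (l + k + 3)) =
     lam / 2 * (l * (l + 3)) + lam / 2 * (k * (k + 3)) + lam * (k * l)"
    by (simp add: field_simps)
  moreover have "pot m \<le> 5 * k - 4 * eta m + lam / 2 * (k * (k + 3))"
    using mult.IH unfolding k_def by (auto split: if_splits)
  moreover have "p \<noteq> 1" using mult(1) by auto
  ultimately show ?case using kl unfolding pm lk eta by (simp add: add_divide_distrib)
qed

section \<open>Stellar subdivisions\<close>

text \<open>Weights are indexed by vectors instead of positions in a family, so cones with common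
  generators share the weight functions on their common face.\<close>

definition combination :: "('v::real_vector \<Rightarrow> real) \<Rightarrow> 'v" where
  "combination a = (\<Sum>w | a w \<noteq> 0. a w *\<^sub>R w)"

text \<open>A complex \<open>T\<close> triangulates \<open>C\<close> iff every point of \<open>C\<close> is the combination of exactly one
  weight function supported on one of its cones, i.e. iff \<open>combination\<close> maps \<open>weights T\<close>
  bijectively onto \<open>C\<close>. In this form the condition is easily carried over to \<open>stellar g T\<close>.\<close>

definition weights :: "('n \<Rightarrow> 'v) set \<Rightarrow> ('v \<Rightarrow> real) set" where
  "weights T = {a. (\<forall>w. 0 \<le> a w) \<and> (\<exists>f\<in>T. {w. a w \<noteq> 0} \<subseteq> range f)}"

definition stellar :: "('v::real_vector \<Rightarrow> real) \<Rightarrow> ('n \<Rightarrow> 'v) set \<Rightarrow> ('n \<Rightarrow> 'v) set" where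
  "stellar g T = {f \<in> T. \<not> {w. g w \<noteq> 0} \<subseteq> range f} \<union>
     {f(i := combination g) | f i. f \<in> T \<and> {w. g w \<noteq> 0} \<subseteq> range f \<and> g (f i) \<noteq> 0}"

lemma combination_superset:
  assumes "finite F" "{w. a w \<noteq> 0} \<subseteq> F"
  shows "combination a = (\<Sum>w\<in>F. a w *\<^sub>R w)"
  unfolding combination_def using assms by (intro sum.mono_neutral_left) auto

lemma combination_range:
  fixes f :: "'n::finite \<Rightarrow> 'v::real_vector"
  assumes "inj f" "{w. a w \<noteq> 0} \<subseteq> range f"
  shows "combination a = (\<Sum>i\<in>UNIV. a (f i) *\<^sub>R f i)"
  using combination_superset[of "range f" a] assms by (simp add: sum.reindex)

lemma combination_add_scale:
  assumes "finite {w. a w \<noteq> 0}" "finite {w. b w \<noteq> 0}"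
  shows "combination (\<lambda>w. a w + t * b w) = combination a + t *\<^sub>R combination b"
proof -
  define F where "F = {w. a w \<noteq> 0} \<union> {w. b w \<noteq> 0}"
  have "combination (\<lambda>w. a w + t * b w) = (\<Sum>w\<in>F. (a w + t * b w) *\<^sub>R w)"
    using assms by (intro combination_superset) (auto simp: F_def)
  also have "\<dots> = (\<Sum>w\<in>F. a w *\<^sub>R w) + t *\<^sub>R (\<Sum>w\<in>F. b w *\<^sub>R w)"
    by (simp add: scaleR_add_left sum.distrib scaleR_sum_right)
  also have "\<dots> = combination a + t *\<^sub>R combination b"
  proof -
    have "combination a = (\<Sum>w\<in>F. a w *\<^sub>R w)" "combination b = (\<Sum>w\<in>F. b w *\<^sub>R w)"
      using assms by (intro combination_superset; auto simp: F_def)+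
    then show ?thesis by simp
  qed
  finally show ?thesis .
qed

lemma combination_single [simp]: "combination (\<lambda>w. if w = x then t else 0) = t *\<^sub>R x"
proof -
  have "combination (\<lambda>w. if w = x then t else 0) = (\<Sum>w\<in>{x}. (if w = x then t else 0) *\<^sub>R w)"
    by (intro combination_superset) auto
  then show ?thesis by simp
qed

lemma finite_support_weights:
  fixes T :: "('n::finite \<Rightarrow> 'v) set"
  shows "a \<in> weights T \<Longrightarrow> finite {w. a w \<noteq> 0}"
  unfolding weights_def by (auto intro: finite_subset)

text \<open>Old and new weight functions of a point determine each other. As x is not a vertex of T,
  the old ones vanish at x, and the new value at x records the multiple of g that was exchanged for
  x.\<close>

lemma stellar_bij_betw:
  fixes T :: "('n::finite \<Rightarrow> 'v::real_vector) set"
  assumes bij: "bij_betw combination (weights T) C"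
    and inj: "\<And>f. f \<in> T \<Longrightarrow> inj f"
    and g: "g \<in> weights T" "{w. g w \<noteq> 0} \<noteq> {}"
    and x: "\<And>f. f \<in> T \<Longrightarrow> combination g \<notin> range f"
  shows "bij_betw combination (weights (stellar g T)) C"
proof -
  define S where "S = {w. g w \<noteq> 0}"
  define x where "x = combination g"
  \<comment> \<open>Substitute the given combination for the new vertex \<open>x\<close>. The inverse takes off the largest
      multiple of \<open>g\<close> that keeps the weights nonnegative.\<close>
  define \<Phi> where "\<Phi> = (\<lambda>a w. (if w = x then 0 else a w) + a x * g w)"
  have g0: "g w \<ge> 0" for w using g by (simp add: weights_def)
  have finS: "finite S" using finite_support_weights[OF g(1)] by (simp add: S_def)
  have gx: "g x = 0" using g x unfolding weights_def x_def by blast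
  have stl: "stellar g T = {f \<in> T. \<not> S \<subseteq> range f} \<union>
     {f(i := x) | f i. f \<in> T \<and> S \<subseteq> range f \<and> f i \<in> S}"
    by (simp add: stellar_def S_def x_def)
  \<comment> \<open>No cone of the subdivision contains all of S, so a new weight function vanishes
    somewhere on S. This makes its value at x recoverable.\<close>
  have fwd: "\<Phi> a \<in> weights T \<and> (\<exists>s\<in>S. a s = 0) \<and> combination (\<Phi> a) = combination a"
    if a: "a \<in> weights (stellar g T)" for a
  proof -
    have a0: "a w \<ge> 0" for w using a by (simp add: weights_def)
    obtain h where h: "h \<in> stellar g T" "{w. a w \<noteq> 0} \<subseteq> range h"
      using a by (auto simp: weights_def)
    have \<Phi>0: "\<Phi> a w \<ge> 0" for w using a0 g0 by (simp add: \<Phi>_def)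
    have main: "(\<exists>f\<in>T. {w. \<Phi> a w \<noteq> 0} \<subseteq> range f) \<and> (\<exists>s\<in>S. a s = 0)"
    proof -
      consider "h \<in> T" "\<not> S \<subseteq> range h"
        | f i where "h = f(i := x)" "f \<in> T" "S \<subseteq> range f" "f i \<in> S"
        using h(1) unfolding stl by blast
      then show ?thesis
      proof cases
        case 1
        have "a x = 0" using h(2) x[OF 1(1)] unfolding x_def by blast
        then have "{w. \<Phi> a w \<noteq> 0} \<subseteq> range h" using h by (auto simp: \<Phi>_def)
        moreover have "\<exists>s\<in>S. a s = 0" using 1 h(2) by blast
        ultimately show ?thesis using 1 by blast
      next
        case 2
        have rh: "range h \<subseteq> insert x (range f - {f i})"
          using 2 inj[OF 2(2)] by (auto simp: inj_def)
        have "f i \<noteq> x" using x[OF 2(2)] unfolding x_def by (metis rangeI)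
        then have "a (f i) = 0" using rh h(2) by blast
        moreover have "{w. \<Phi> a w \<noteq> 0} \<subseteq> range f"
        proof
          fix w assume "w \<in> {w. \<Phi> a w \<noteq> 0}"
          then have "w \<noteq> x \<and> (a w \<noteq> 0 \<or> g w \<noteq> 0)" using gx by (auto simp: \<Phi>_def split: if_splits)
          then show "w \<in> range f" using rh h(2) 2(3) unfolding S_def by blast
        qed
        ultimately show ?thesis using 2 by blast
      qed
    qed
    moreover have "combination (\<Phi> a) = combination a"
    proof -
      have fa: "finite {w. a w \<noteq> 0}" using finite_support_weights[OF a] .
      define r where "r = (\<lambda>w. if w = x then 0 else a w)"
      have fr: "finite {w. r w \<noteq> 0}" using fa by (rule rev_finite_subset) (auto simp: r_def)
      have "combination (\<Phi> a) = combination r + a x *\<^sub>R combination g"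
        using combination_add_scale[OF fr, of g "a x"] finS by (simp add: S_def r_def \<Phi>_def)
      also have "\<dots> = combination r + a x *\<^sub>R combination (\<lambda>w. if w = x then 1 else 0)"
        by (simp add: x_def)
      also have "\<dots> = combination (\<lambda>w. r w + a x * (if w = x then 1 else 0))"
        by (rule combination_add_scale[symmetric, OF fr]) simp
      also have "(\<lambda>w. r w + a x * (if w = x then 1 else 0)) = a" by (auto simp: r_def)
      finally show ?thesis .
    qed
    ultimately show ?thesis using \<Phi>0 by (simp add: weights_def)
  qed
  have "inj_on \<Phi> (weights (stellar g T))"
  proof (rule inj_onI)
    fix a b assume a: "a \<in> weights (stellar g T)" and b: "b \<in> weights (stellar g T)"
      and eq: "\<Phi> a = \<Phi> b"
    have a0: "a w \<ge> 0" and b0: "b w \<ge> 0" for w using a b by (simp_all add: weights_def)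
    have le: "a' x \<le> b' x"
      if ex: "\<exists>s\<in>S. b' s = 0" and "\<Phi> a' = \<Phi> b'" and "\<And>w. a' w \<ge> 0" for a' b' :: "'v \<Rightarrow> real"
    proof -
      obtain s where s: "s \<in> S" "b' s = 0" using ex by blast
      then have gs: "g s > 0" "s \<noteq> x" using g0[of s] gx by (auto simp: S_def)
      have "\<Phi> a' s = \<Phi> b' s" using that(2) by simp
      then have "a' s + a' x * g s = b' x * g s" using s gs by (simp add: \<Phi>_def)
      moreover have "a' s \<ge> 0" using that(3) .
      ultimately have "a' x * g s \<le> b' x * g s" by linarith
      then show ?thesis using gs by simp
    qed
    have "a x = b x"
      using le[of b a] le[of a b] fwd[OF a] fwd[OF b] eq a0 b0 by (simp add: order_antisym)
    moreover have "a w = b w" if "w \<noteq> x" for w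
      using fun_cong[OF eq, of w] that \<open>a x = b x\<close> by (simp add: \<Phi>_def)
    ultimately show "a = b" by (intro ext) metis
  qed
  moreover have "\<Phi> ` weights (stellar g T) = weights T"
  proof (intro equalityI subsetI)
    fix b assume "b \<in> \<Phi> ` weights (stellar g T)"
    then show "b \<in> weights T" using fwd by blast
  next
    fix b assume b: "b \<in> weights T"
    then obtain f where f: "f \<in> T" "{w. b w \<noteq> 0} \<subseteq> range f" by (auto simp: weights_def)
    have b0: "b w \<ge> 0" for w using b by (simp add: weights_def)
    have bx: "b x = 0" using f x unfolding x_def by blast
    define t where "t = (if S \<subseteq> {w. b w \<noteq> 0} then Min ((\<lambda>s. b s / g s) ` S) else 0)"
    define a where "a = (\<lambda>w. if w = x then t else b w - t * g w)"
    have tle: "t \<le> b s / g s" if "s \<in> S" for s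
      using that finS b0 g0 by (auto simp: t_def)
    have t0: "t \<ge> 0"
      using finS b0 g0 g(2) by (auto simp: t_def S_def)
    have a0: "a w \<ge> 0" for w
    proof (cases "w \<in> S")
      case True
      then have "g w > 0" using g0[of w] by (simp add: S_def)
      then show ?thesis using tle[OF True] t0 by (simp add: a_def field_simps)
    next
      case False
      then show ?thesis using t0 b0 by (simp add: a_def S_def)
    qed
    have "\<exists>h\<in>stellar g T. {w. a w \<noteq> 0} \<subseteq> range h"
    proof (cases "S \<subseteq> range f")
      case False
      then have "t = 0" using f by (auto simp: t_def)
      then have "{w. a w \<noteq> 0} \<subseteq> range f" using f by (auto simp: a_def)
      then show ?thesis using f False unfolding stl by blast
    next
      case True
      \<comment> \<open>Either the minimum is attained at s, where subtracting t * g leaves 0, or b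
        already vanishes on S somewhere. The generator of weight 0 is the one that x
        replaces.\<close>
      have "\<exists>s\<in>S. a s = 0"
      proof (cases "S \<subseteq> {w. b w \<noteq> 0}")
        case True
        have "t \<in> (\<lambda>s. b s / g s) ` S" using True finS g(2) unfolding t_def S_def by auto
        then obtain s where s: "s \<in> S" "t = b s / g s" by blast
        then have "a s = 0" using gx by (auto simp: a_def S_def)
        then show ?thesis using s by blast
      next
        case False
        then obtain s where s: "s \<in> S" "b s = 0" by blast
        then have "s \<noteq> x" using gx by (auto simp: S_def)
        moreover have "t = 0" using False by (simp add: t_def)
        ultimately show ?thesis using s by (auto simp: a_def)
      qed
      then obtain i where i: "f i \<in> S" "a (f i) = 0" using True by blast
      have "range f - {f i} \<subseteq> range (f(i := x))" by auto
      moreover have "x \<in> range (f(i := x))" by auto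
      moreover have "{w. a w \<noteq> 0} \<subseteq> insert x (range f - {f i})"
      proof
        fix w assume "w \<in> {w. a w \<noteq> 0}"
        then have "w = x \<or> b w \<noteq> 0 \<or> g w \<noteq> 0" "w \<noteq> f i" using i by (auto simp: a_def)
        then show "w \<in> insert x (range f - {f i})" using f(2) True unfolding S_def by blast
      qed
      ultimately have "{w. a w \<noteq> 0} \<subseteq> range (f(i := x))" by blast
      then show ?thesis using f i True unfolding stl by blast
    qed
    then have "a \<in> weights (stellar g T)" using a0 by (simp add: weights_def)
    moreover have "\<Phi> a = b" using gx bx by (auto simp: \<Phi>_def a_def)
    ultimately show "b \<in> \<Phi> ` weights (stellar g T)" by blast
  qed
  ultimately have "bij_betw \<Phi> (weights (stellar g T)) (weights T)" by (simp add: bij_betw_def)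
  then have "bij_betw (combination \<circ> \<Phi>) (weights (stellar g T)) C" using bij by (rule bij_betw_trans)
  then show ?thesis using fwd by (subst bij_betw_cong[of _ _ "combination \<circ> \<Phi>"]) auto
qed

section \<open>Lattice points of a simplicial cone\<close>

lemma det_lattice:
  fixes f :: "'n::finite \<Rightarrow> real ^ 'n"
  assumes "\<And>i. f i \<in> lattice_pts"
  shows "det (\<chi> i. f i) \<in> \<int>"
  unfolding det_def using assms by (force simp: lattice_pts_def intro!: Ints_sum Ints_mult Ints_prod)

lemma real_cone_mult_lattice:
  fixes f :: "'n::finite \<Rightarrow> real ^ 'n"
  assumes "\<And>i. f i \<in> lattice_pts"
  shows "real (cone_mult f) = \<bar>det (\<chi> i. f i)\<bar>"
  using Ints_abs[OF det_lattice[OF assms]] unfolding cone_mult_def by (auto elim!: Ints_cases)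

lemma det_update:
  fixes f :: "'n::finite \<Rightarrow> real ^ 'n"
  assumes "x = (\<Sum>j\<in>UNIV. c j *\<^sub>R f j)"
  shows "det (\<chi> k. (f(i := x)) k) = c i * det (\<chi> k. f k)"
proof -
  have "x = (\<Sum>j\<in>UNIV. (\<chi> j. c j) $ j *s row j (\<chi> k. f k))"
    using assms by (simp add: row_def scalar_mult_eq_scaleR)
  then have "(\<chi> k. (f(i := x)) k) =
    (\<chi> k. if k = i then \<Sum>j\<in>UNIV. (\<chi> j. c j) $ j *s row j (\<chi> k. f k) else row k (\<chi> k. f k))"
    by (simp add: vec_eq_iff row_def)
  then show ?thesis using cramer_lemma_transpose[of i "\<chi> j. c j" "\<chi> k. f k"] by simp
qed

lemma det_nonzero_iff:
  fixes f :: "'n::finite \<Rightarrow> real ^ 'n"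
  shows "det (\<chi> i. f i) \<noteq> 0 \<longleftrightarrow> (\<forall>c. (\<Sum>i\<in>UNIV. c i *\<^sub>R f i) = 0 \<longrightarrow> (\<forall>i. c i = 0))"
proof -
  have "row i (\<chi> i. f i) = f i" for i by (simp add: row_def vec_eq_iff)
  then show ?thesis
    using matrix_right_invertible_independent_rows[of "\<chi> i. f i"]
    by (simp add: invertible_det_nz[symmetric] invertible_right_inverse scalar_mult_eq_scaleR)
qed

lemma det_nonzero_inj:
  fixes f :: "'n::finite \<Rightarrow> real ^ 'n"
  assumes "det (\<chi> i. f i) \<noteq> 0" shows "inj f"
proof (rule injI, rule ccontr)
  fix i j assume "f i = f j" "i \<noteq> j"
  then have "det (\<chi> i. f i) = 0" by (intro det_identical_rows[of i j]) (auto simp: row_def vec_eq_iff)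
  then show False using assms by simp
qed

lemma det_nonzero_iff_independent:
  fixes f :: "'n::finite \<Rightarrow> real ^ 'n"
  assumes "inj f"
  shows "det (\<chi> i. f i) \<noteq> 0 \<longleftrightarrow> independent (range f)"
proof -
  have "independent (range f) \<longleftrightarrow> (\<forall>u. (\<Sum>i\<in>UNIV. u (f i) *\<^sub>R f i) = 0 \<longrightarrow> (\<forall>i. u (f i) = 0))"
    using assms by (subst dependent_finite) (auto simp: sum.reindex)
  also have "\<dots> \<longleftrightarrow> (\<forall>c. (\<Sum>i\<in>UNIV. c i *\<^sub>R f i) = 0 \<longrightarrow> (\<forall>i. c i = 0))" (is "?L \<longleftrightarrow> ?R")
  proof
    assume L: ?L
    show ?R
    proof (intro allI impI)
      fix c i assume "(\<Sum>i\<in>UNIV. c i *\<^sub>R f i) = 0"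
      then show "c i = 0" using L[rule_format, of "\<lambda>w. c (inv f w)" i] assms by simp
    qed
  next
    assume R: ?R
    show ?L using R[rule_format, of "\<lambda>i. _ (f i)"] by blast
  qed
  finally show ?thesis by (simp only: det_nonzero_iff)
qed

text \<open>Cramer's rule: up to sign, the product is the determinant with row i replaced by the
  lattice point.\<close>

lemma lattice_coordinates_integral:
  fixes f :: "'n::finite \<Rightarrow> real ^ 'n"
  assumes "\<And>i. f i \<in> lattice_pts" "(\<Sum>j\<in>UNIV. c j *\<^sub>R f j) \<in> lattice_pts"
  shows "c i * real (cone_mult f) \<in> \<int>"
proof -
  have "det (\<chi> k. (f(i := \<Sum>j\<in>UNIV. c j *\<^sub>R f j)) k) \<in> \<int>"
    using assms by (intro det_lattice) auto
  then have "c i * det (\<chi> k. f k) \<in> \<int>" by (simp only: det_update[OF refl])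
  then have "c i * det (\<chi> k. f k) \<in> \<int>" "- (c i * det (\<chi> k. f k)) \<in> \<int>" by auto
  then show ?thesis unfolding real_cone_mult_lattice[OF assms(1)]
    by (cases "det (\<chi> k. f k) \<ge> 0") auto
qed

lemma exists_prime_torsion:
  fixes f :: "'n::finite \<Rightarrow> real ^ 'n"
  assumes f: "\<And>i. f i \<in> lattice_pts" and det: "det (\<chi> i. f i) \<noteq> 0" and m: "cone_mult f \<noteq> 1"
  shows "\<exists>p y. prime p \<and> (\<forall>j. real p * y j \<in> \<int>) \<and> (\<exists>j. y j \<notin> \<int>) \<and>
    (\<Sum>j\<in>UNIV. y j *\<^sub>R f j) \<in> lattice_pts"
proof -
  \<comment> \<open>Some row of the inverse matrix is not integral; multiply it by \<open>k / p\<close>, where \<open>k\<close> is its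
      least common denominator and \<open>p\<close> a prime divisor of \<open>k\<close>.\<close>
  define A where "A = (\<chi> i. f i)"
  obtain Y where YA: "Y ** A = mat 1"
    using det invertible_det_nz[of A] unfolding A_def[symmetric] invertible_def by blast
  have row: "(\<Sum>j\<in>UNIV. Y $ i $ j *\<^sub>R f j) = mat 1 $ i" for i
    unfolding YA[symmetric] by (simp add: vec_eq_iff matrix_matrix_mult_def A_def)
  have latrow: "(\<Sum>j\<in>UNIV. Y $ i $ j *\<^sub>R f j) \<in> lattice_pts" for i
    unfolding row by (auto simp: lattice_pts_def mat_def)
  have "\<exists>i j. Y $ i $ j \<notin> \<int>"
  proof (rule ccontr)
    assume "\<not> ?thesis"
    then have "det (\<chi> i. Y $ i) \<in> \<int>" by (intro det_lattice) (auto simp: lattice_pts_def)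
    then have "det Y \<in> \<int>" by simp
    then obtain a where a: "det Y = of_int a" by (auto elim: Ints_cases)
    obtain b where b: "det A = of_int b" using det_lattice[of f] f by (auto simp: A_def elim: Ints_cases)
    have "det Y * det A = 1" using YA by (metis det_I det_mul)
    then have "a * b = 1" using a b by (metis of_int_1 of_int_eq_iff of_int_mult)
    then have "\<bar>b\<bar> = 1" by (metis abs_mult_self_eq abs_zmult_eq_1 abs_one mult.commute)
    then have "real (cone_mult f) = 1"
      using real_cone_mult_lattice[OF f] b by (simp add: A_def flip: of_int_abs)
    then show False using m by simp
  qed
  then obtain i j0 where j0: "Y $ i $ j0 \<notin> \<int>" by blast
  define P where "P = (\<lambda>k. k > 0 \<and> (\<forall>j. real k * Y $ i $ j \<in> \<int>))"
  have "P (cone_mult f)"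
  proof -
    have "real (cone_mult f) = \<bar>det (\<chi> i. f i)\<bar>" by (rule real_cone_mult_lattice) (rule f)
    then have "cone_mult f > 0" using det by (simp flip: of_nat_0_less_iff)
    moreover have "real (cone_mult f) * Y $ i $ j \<in> \<int>" for j
      using lattice_coordinates_integral[OF f latrow] by (simp add: mult.commute)
    ultimately show ?thesis by (simp add: P_def)
  qed
  then have Pk: "P (LEAST k. P k)" by (rule LeastI)
  define k where "k = (LEAST k. P k)"
  have "k \<noteq> 1" using Pk j0 unfolding k_def[symmetric] by (auto simp: P_def)
  then obtain p where p: "prime p" "p dvd k" using prime_factor_nat by blast
  then obtain q where q: "k = p * q" by blast
  have k0: "k > 0" using Pk by (simp add: P_def k_def)
  then have "q > 0" "q < k" using q prime_gt_1_nat[OF p(1)] by auto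
  then have "\<not> P q" unfolding k_def by (metis not_less_Least)
  then have "\<exists>j. real q * Y $ i $ j \<notin> \<int>" using \<open>q > 0\<close> by (simp add: P_def)
  moreover have "real p * (real q * Y $ i $ j) \<in> \<int>" for j
  proof -
    have "P k" unfolding k_def by (rule Pk)
    then have "real (p * q) * Y $ i $ j \<in> \<int>" by (simp add: P_def flip: q)
    then show ?thesis by (simp add: mult.assoc)
  qed
  moreover have "(\<Sum>j\<in>UNIV. (real q * Y $ i $ j) *\<^sub>R f j) \<in> lattice_pts"
  proof -
    have "(\<Sum>j\<in>UNIV. (real q * Y $ i $ j) *\<^sub>R f j) = real q *\<^sub>R (\<Sum>j\<in>UNIV. Y $ i $ j *\<^sub>R f j)"
      by (simp add: scaleR_sum_right)
    then show ?thesis using latrow[of i] by (auto simp: lattice_pts_def)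
  qed
  ultimately show ?thesis using p(1) by (intro exI[of _ p] exI[of _ "\<lambda>j. real q * Y $ i $ j"]) auto
qed

section \<open>Refinement\<close>

lemma lattice_integral_combination:
  assumes "\<And>j. f j \<in> lattice_pts" "\<And>j. c j \<in> \<int>"
  shows "(\<Sum>j\<in>A. c j *\<^sub>R f j) \<in> lattice_pts"
  using assms by (auto simp: lattice_pts_def sum_component intro!: Ints_sum Ints_mult)

lemma lattice_add: "x \<in> lattice_pts \<Longrightarrow> y \<in> lattice_pts \<Longrightarrow> x + y \<in> lattice_pts"
  by (auto simp: lattice_pts_def)

text \<open>Shifting the coefficients from \<open>exists_prime_torsion\<close> by integers stays in
  the lattice, so each moves to an admissible N j / p, the integral ones to 0. One coefficient stays
  fractional; this will show that x is a new vertex.\<close>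

lemma exists_subdivision_coefficients:
  fixes f :: "'n::finite \<Rightarrow> real ^ 'n"
  assumes f: "\<And>i. f i \<in> lattice_pts" and det: "det (\<chi> i. f i) \<noteq> 0" and m: "cone_mult f \<noteq> 1"
  shows "\<exists>p T N. prime p \<and> lam \<le> T \<and>
    (\<forall>j. N j = 0 \<or> 1 + real (N j) / real p \<le> 2 powr T \<and> T + pot (N j) \<le> prime_pot p) \<and>
    (\<exists>j. real (N j) / real p \<notin> \<int>) \<and>
    (\<Sum>j\<in>UNIV. (real (N j) / real p) *\<^sub>R f j) \<in> lattice_pts"
proof -
  obtain p y where py: "prime p" "\<And>j. real p * y j \<in> \<int>" "\<exists>j. y j \<notin> \<int>"
    "(\<Sum>j\<in>UNIV. y j *\<^sub>R f j) \<in> lattice_pts"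
    using exists_prime_torsion[OF f det m] by blast
  obtain T where T: "T \<ge> lam" "\<And>z. 0 < z \<Longrightarrow> z < p \<Longrightarrow> admissible p T z"
    using admissible_exists[OF py(1)] by blast
  have p0: "p > 0" using py(1) prime_gt_0_nat by blast
  define k where "k = (\<lambda>j. \<lfloor>real p * y j\<rfloor>)"
  have k: "real p * y j = of_int (k j)" for j
    using py(2)[of j] by (auto simp: k_def elim: Ints_cases)
  have "\<exists>N. (N = 0 \<or> 1 + real N / real p \<le> 2 powr T \<and> T + pot N \<le> prime_pot p) \<and>
    int N mod int p = k j mod int p" for j
  proof (cases "k j mod int p = 0")
    case True
    then show ?thesis by (intro exI[of _ 0]) simp
  next
    case False
    define z where "z = nat (k j mod int p)"
    have z: "int z = k j mod int p" using p0 by (simp add: z_def)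
    then have "int z < int p" "int z \<noteq> 0" using False p0 by simp_all
    then have "0 < z" "z < p" by auto
    then obtain N where N: "N mod p = z" "1 + real N / real p \<le> 2 powr T" "T + pot N \<le> prime_pot p"
      using T(2) unfolding admissible_def by blast
    then have "int N mod int p = k j mod int p" using z by (metis zmod_int)
    then show ?thesis using N by blast
  qed
  then obtain N where N: "\<And>j. N j = 0 \<or> 1 + real (N j) / real p \<le> 2 powr T \<and> T + pot (N j) \<le> prime_pot p"
    "\<And>j. int (N j) mod int p = k j mod int p" by metis
  have diff: "real (N j) / real p - y j \<in> \<int>" for j
  proof -
    obtain q where q: "int (N j) - k j = int p * q"
      using N(2)[of j] by (metis dvdE mod_eq_dvd_iff)
    have "real (N j) - real p * y j = real p * of_int q"
      unfolding k using arg_cong[OF q, of real_of_int] by simp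
    then have "real (N j) / real p - y j = of_int q" using p0 by (simp add: field_simps)
    then show ?thesis by simp
  qed
  have "\<exists>j. real (N j) / real p \<notin> \<int>"
  proof -
    obtain j where "y j \<notin> \<int>" using py(3) by blast
    then have "real (N j) / real p \<notin> \<int>" using Ints_diff[OF _ diff[of j]] by fastforce
    then show ?thesis by blast
  qed
  moreover have "(\<Sum>j\<in>UNIV. (real (N j) / real p) *\<^sub>R f j) \<in> lattice_pts"
  proof -
    have "(\<Sum>j\<in>UNIV. (real (N j) / real p) *\<^sub>R f j) =
      (\<Sum>j\<in>UNIV. y j *\<^sub>R f j) + (\<Sum>j\<in>UNIV. (real (N j) / real p - y j) *\<^sub>R f j)"
      by (simp add: sum.distrib[symmetric] scaleR_left_diff_distrib)
    then show ?thesis using lattice_add[OF py(4) lattice_integral_combination[OF f diff]] by simp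
  qed
  ultimately show ?thesis using py(1) T(1) N(1) by blast
qed

definition bounded_complex ::
    "('n::finite \<Rightarrow> real ^ 'n) set \<Rightarrow> (real ^ 'n) set \<Rightarrow> (real ^ 'n \<Rightarrow> real) \<Rightarrow> real \<Rightarrow> bool" where
  "bounded_complex T C \<tau> K \<longleftrightarrow> finite T \<and> bij_betw combination (weights T) C \<and>
     (\<forall>f\<in>T. (\<forall>i. f i \<in> lattice_pts) \<and> det (\<chi> i. f i) \<noteq> 0 \<and>
        (\<Sum>i\<in>UNIV. \<tau> (f i)) * 2 powr pot (cone_mult f) \<le> K)"

definition level :: "('n::finite \<Rightarrow> real ^ 'n) \<Rightarrow> nat" where
  "level f = nat \<lfloor>pot (cone_mult f) / lam\<rfloor>"

text \<open>With d = \<open>CARD('n)\<close>, a subdivided cone of level k yields at most d cones of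
  lower level, and d * (d + 1)^(k - 1) < (d + 1)^k.\<close>

definition complexity :: "('n::finite \<Rightarrow> real ^ 'n) set \<Rightarrow> nat" where
  "complexity T = (\<Sum>f\<in>T. (CARD('n) + 1) ^ level f)"

lemma cone_mult_pos:
  fixes f :: "'n::finite \<Rightarrow> real ^ 'n"
  assumes "\<And>i. f i \<in> lattice_pts" "det (\<chi> i. f i) \<noteq> 0"
  shows "cone_mult f > 0"
  using real_cone_mult_lattice[of f] assms by (simp flip: of_nat_0_less_iff)

lemma generator_in_carrier:
  assumes "bij_betw combination (weights T) C" "f \<in> T"
  shows "f i \<in> C"
proof -
  have "(\<lambda>w. if w = f i then 1 else 0) \<in> weights T"
    using assms(2) by (auto simp: weights_def)
  then have "combination (\<lambda>w. if w = f i then 1 else 0) \<in> C"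
    using bij_betwE[OF assms(1)] by blast
  then show ?thesis by simp
qed

lemma level_less:
  assumes "pot (cone_mult h) \<le> pot (cone_mult f) - T" "lam \<le> T"
  shows "level h < level f"
proof -
  have "pot (cone_mult h) / lam \<le> (pot (cone_mult f) - lam) / lam"
    using assms lam_bounds by (intro divide_right_mono) auto
  also have "\<dots> = pot (cone_mult f) / lam - 1" using lam_bounds by (simp add: field_simps)
  finally have "\<lfloor>pot (cone_mult h) / lam\<rfloor> \<le> \<lfloor>pot (cone_mult f) / lam\<rfloor> - 1"
    by (metis floor_diff_one floor_mono)
  \<comment> \<open>Otherwise \<open>nat\<close> might send both floors to 0.\<close>
  moreover have "0 \<le> \<lfloor>pot (cone_mult h) / lam\<rfloor>" using pot_nonneg lam_bounds by simp
  ultimately show ?thesis unfolding level_def by linarith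
qed

lemma complexity_stellar_less:
  fixes T :: "('n::finite \<Rightarrow> real ^ 'n) set"
  assumes fin: "finite T"
    and less: "\<And>f i. f \<in> T \<Longrightarrow> {w. g w \<noteq> 0} \<subseteq> range f \<Longrightarrow> g (f i) \<noteq> 0 \<Longrightarrow>
      level (f(i := combination g)) < level f"
    and ex: "f0 \<in> T" "{w. g w \<noteq> 0} \<subseteq> range f0"
  shows "finite (stellar g T)" "complexity (stellar g T) < complexity T"
proof -
  define x where "x = combination g"
  define A where "A = {f \<in> T. {w. g w \<noteq> 0} \<subseteq> range f}"
  define P where "P = Sigma A (\<lambda>f. {i. g (f i) \<noteq> 0})"
  define wt where "wt = (\<lambda>f :: 'n \<Rightarrow> real ^ 'n. (CARD('n) + 1) ^ level f)"
  have finA: "finite A" "A \<subseteq> T" "f0 \<in> A" using fin ex by (auto simp: A_def)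
  have finP: "finite P" using finA by (simp add: P_def)
  have eq: "stellar g T = (T - A) \<union> (\<lambda>(f, i). f(i := x)) ` P"
    by (auto simp: stellar_def A_def P_def x_def)
  show "finite (stellar g T)" using fin finP by (simp add: eq)
  have child: "(\<Sum>i | g (f i) \<noteq> 0. wt (f(i := x))) < wt f" if f: "f \<in> A" for f
  proof (cases "{i. g (f i) \<noteq> 0} = {}")
    case True
    then show ?thesis by (simp add: wt_def)
  next
    case False
    then obtain i0 where "g (f i0) \<noteq> 0" by blast
    then have l0: "level f > 0" using less[of f i0] f by (auto simp: A_def)
    have "(\<Sum>i | g (f i) \<noteq> 0. wt (f(i := x))) \<le> (\<Sum>i | g (f i) \<noteq> 0. (CARD('n) + 1) ^ (level f - 1))"
    proof (rule sum_mono)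
      fix i assume "i \<in> {i. g (f i) \<noteq> 0}"
      then have "level (f(i := x)) \<le> level f - 1" using less[of f i] f by (auto simp: A_def x_def)
      then show "wt (f(i := x)) \<le> (CARD('n) + 1) ^ (level f - 1)"
        unfolding wt_def by (intro power_increasing) auto
    qed
    also have "\<dots> \<le> CARD('n) * (CARD('n) + 1) ^ (level f - 1)"
      by (simp add: card_mono)
    also have "\<dots> < (CARD('n) + 1) * (CARD('n) + 1) ^ (level f - 1)" by simp
    also have "\<dots> = wt f" using l0 unfolding wt_def by (metis Suc_diff_1 power_Suc)
    finally show ?thesis .
  qed
  \<comment> \<open>New cones are not shown to be distinct from each other or from the kept ones; an
    upper bound suffices.\<close>
  have "complexity (stellar g T) \<le> sum wt (T - A) + sum wt ((\<lambda>(f, i). f(i := x)) ` P)"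
    unfolding complexity_def eq wt_def[symmetric]
    using fin finP by (metis (no_types, lifting) finite_Diff finite_imageI le_add1 sum.union_inter)
  also have "\<dots> \<le> sum wt (T - A) + (\<Sum>(f, i)\<in>P. wt (f(i := x)))"
    using sum_image_le[OF finP, of wt "\<lambda>(f, i). f(i := x)"] by (simp add: o_def case_prod_unfold)
  also have "(\<Sum>(f, i)\<in>P. wt (f(i := x))) = (\<Sum>f\<in>A. \<Sum>i | g (f i) \<noteq> 0. wt (f(i := x)))"
    unfolding P_def using finA by (subst sum.Sigma) auto
  also have "sum wt (T - A) + \<dots> < sum wt (T - A) + sum wt A"
    using finA child by (intro add_strict_left_mono sum_strict_mono) auto
  also have "\<dots> = complexity T"
    unfolding complexity_def wt_def[symmetric] using fin finA by (simp add: sum.subset_diff)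
  finally show "complexity (stellar g T) < complexity T" .
qed

lemma refine_step:
  fixes T :: "('n::finite \<Rightarrow> real ^ 'n) set"
  assumes bc: "bounded_complex T C \<tau> K" and lin: "linear \<tau>" and pos: "\<And>y. y \<in> C \<Longrightarrow> 0 \<le> \<tau> y"
    and f: "f \<in> T" "cone_mult f \<noteq> 1"
  shows "\<exists>T'. bounded_complex T' C \<tau> K \<and> complexity T' < complexity T"
proof -
  have lat: "\<And>h i. h \<in> T \<Longrightarrow> h i \<in> lattice_pts" and det: "\<And>h. h \<in> T \<Longrightarrow> det (\<chi> i. h i) \<noteq> 0"
    and bd: "\<And>h. h \<in> T \<Longrightarrow> (\<Sum>i\<in>UNIV. \<tau> (h i)) * 2 powr pot (cone_mult h) \<le> K"
    and fin: "finite T" and bij: "bij_betw combination (weights T) C"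
    using bc by (auto simp: bounded_complex_def)
  have inj: "inj h" if "h \<in> T" for h using det_nonzero_inj[OF det[OF that]] .
  have \<tau>0: "\<tau> (h i) \<ge> 0" if "h \<in> T" for h i
    using pos generator_in_carrier[OF bij that] by blast
  obtain p t N where pN: "prime p" "lam \<le> t"
    "\<And>j. N j = 0 \<or> 1 + real (N j) / real p \<le> 2 powr t \<and> t + pot (N j) \<le> prime_pot p"
    "\<exists>j. real (N j) / real p \<notin> \<int>"
    "(\<Sum>j\<in>UNIV. (real (N j) / real p) *\<^sub>R f j) \<in> lattice_pts"
    using exists_subdivision_coefficients[of f] lat[OF f(1)] det[OF f(1)] f(2) by blast
  have p0: "p > 0" using pN(1) prime_gt_0_nat by blast
  \<comment> \<open>The coefficients are moved from the positions in f to vectors, so that they make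
    sense in every cone containing S.\<close>
  define g where "g = (\<lambda>w. if w \<in> range f then real (N (inv f w)) / real p else 0)"
  have gf: "g (f j) = real (N j) / real p" for j using inj[OF f(1)] by (simp add: g_def)
  have gN: "\<exists>j. g w = real (N j) / real p" if "g w \<noteq> 0" for w
    using that unfolding g_def by (auto split: if_splits)
  define S where "S = {w. g w \<noteq> 0}"
  have Sf: "S \<subseteq> range f" by (auto simp: S_def g_def)
  have gW: "g \<in> weights T" using Sf f(1) unfolding weights_def S_def by (auto simp: g_def)
  define x where "x = combination g"
  have "x = (\<Sum>j\<in>UNIV. (real (N j) / real p) *\<^sub>R f j)"
    unfolding x_def using combination_range[OF inj[OF f(1)] Sf[unfolded S_def]] by (simp add: gf)
  then have xlat: "x \<in> lattice_pts" using pN(5) by simp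
  obtain j0 where j0: "g (f j0) \<notin> \<int>" using pN(4) gf by auto
  then have "g (f j0) \<noteq> 0" by (metis Ints_0)
  then have Sne: "S \<noteq> {}" by (auto simp: S_def)
  \<comment> \<open>As a generator, x would have both its indicator and g as weight functions.
    Uniqueness equates them, against the fractional value of g at f j0.\<close>
  have xnew: "x \<notin> range h" if h: "h \<in> T" for h
  proof
    assume "x \<in> range h"
    then have "(\<lambda>w. if w = x then 1 else 0) \<in> weights T" using h by (auto simp: weights_def)
    moreover have "combination (\<lambda>w. if w = x then 1 else 0) = combination g" by (simp add: x_def)
    ultimately have eq: "(\<lambda>w. if w = x then 1 else 0) = g"
      using bij gW unfolding bij_betw_def inj_on_def by blast
    have "g (f j0) = (if f j0 = x then 1 else 0)" using fun_cong[OF eq, of "f j0"] by simp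
    then show False using j0 by (auto split: if_splits)
  qed
  have t0: "2 powr t \<ge> 1" using pN(2) lam_bounds by (intro ge_one_powr_ge_zero) auto
  have gle: "g w \<le> 2 powr t - 1" "g w \<ge> 0" for w
  proof -
    show "g w \<le> 2 powr t - 1"
    proof (cases "g w = 0")
      case True
      then show ?thesis using t0 by simp
    next
      case False
      then obtain j where "g w = real (N j) / real p" using gN by blast
      then show ?thesis using pN(3)[of j] False by auto
    qed
    show "g w \<ge> 0" by (simp add: g_def)
  qed
  have child: "(\<forall>k. (h(i := x)) k \<in> lattice_pts) \<and> det (\<chi> k. (h(i := x)) k) \<noteq> 0 \<and>
      pot (cone_mult (h(i := x))) \<le> pot (cone_mult h) - t \<and>
      (\<Sum>k\<in>UNIV. \<tau> ((h(i := x)) k)) \<le> 2 powr t * (\<Sum>k\<in>UNIV. \<tau> (h k))"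
    if h: "h \<in> T" "S \<subseteq> range h" "g (h i) \<noteq> 0" for h i
  proof -
    have xh: "x = (\<Sum>k\<in>UNIV. g (h k) *\<^sub>R h k)"
      unfolding x_def using combination_range[OF inj[OF h(1)] h(2)[unfolded S_def]] .
    have l: "(h(i := x)) k \<in> lattice_pts" for k using lat[OF h(1)] xlat by simp
    have d: "det (\<chi> k. (h(i := x)) k) = g (h i) * det (\<chi> k. h k)"
      by (rule det_update[OF xh])
    then have d0: "det (\<chi> k. (h(i := x)) k) \<noteq> 0" using h(3) det[OF h(1)] by simp
    obtain j where j: "g (h i) = real (N j) / real p" using gN[OF h(3)] by blast
    then have Nj: "N j > 0" using h(3) by (cases "N j") auto
    have "real (cone_mult (h(i := x))) = g (h i) * real (cone_mult h)"
      using real_cone_mult_lattice[of "h(i := x)"] real_cone_mult_lattice[of h] l lat[OF h(1)] d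
        gle(2)[of "h i"] by (simp add: abs_mult)
    then have "real (p * cone_mult (h(i := x))) = real (N j * cone_mult h)"
      using p0 unfolding j by simp
    \<comment> \<open>Cleared of denominators, so that \<open>pot_mult\<close> applies to both
      sides.\<close>
    then have eq: "p * cone_mult (h(i := x)) = N j * cone_mult h" by (simp only: of_nat_eq_iff)
    have c0: "cone_mult h > 0" "cone_mult (h(i := x)) > 0"
      using cone_mult_pos[of h] cone_mult_pos[of "h(i := x)"] lat[OF h(1)] det[OF h(1)] l d0 by auto
    have "prime_pot p + pot (cone_mult (h(i := x))) = pot (N j) + pot (cone_mult h)"
      using arg_cong[OF eq, of pot] c0 p0 Nj pN(1) by (simp add: pot_mult pot_prime)
    then have pt: "pot (cone_mult (h(i := x))) \<le> pot (cone_mult h) - t"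
      using pN(3)[of j] Nj by auto
    have "\<tau> x = (\<Sum>k\<in>UNIV. g (h k) * \<tau> (h k))"
      unfolding xh using lin by (simp add: linear_sum linear_scale)
    also have "\<dots> \<le> (\<Sum>k\<in>UNIV. (2 powr t - 1) * \<tau> (h k))"
      using gle \<tau>0[OF h(1)] by (intro sum_mono mult_right_mono) auto
    finally have tx: "\<tau> x \<le> (2 powr t - 1) * (\<Sum>k\<in>UNIV. \<tau> (h k))" by (simp add: sum_distrib_left)
    have "(\<Sum>k\<in>UNIV. \<tau> ((h(i := x)) k)) = \<tau> x + (\<Sum>k\<in>UNIV - {i}. \<tau> (h k))"
      by (subst sum.remove[of _ i]) auto
    \<comment> \<open>The length of the replaced generator is given away: the sum is charged for all
      of \<open>\<tau> x\<close>.\<close>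
    also have "(\<Sum>k\<in>UNIV - {i}. \<tau> (h k)) \<le> (\<Sum>k\<in>UNIV. \<tau> (h k))"
      using \<tau>0[OF h(1)] by (intro sum_mono2) auto
    finally have "(\<Sum>k\<in>UNIV. \<tau> ((h(i := x)) k)) \<le> 2 powr t * (\<Sum>k\<in>UNIV. \<tau> (h k))"
      using tx by (simp add: algebra_simps)
    then show ?thesis using l d0 pt by blast
  qed
  have cx: "finite (stellar g T)" "complexity (stellar g T) < complexity T"
    using complexity_stellar_less[OF fin _ f(1), of g] child level_less pN(2) Sf
    unfolding S_def x_def by blast+
  have "bij_betw combination (weights (stellar g T)) C"
    using bij inj gW Sne xnew unfolding S_def x_def by (intro stellar_bij_betw) auto
  moreover have "(\<forall>k. h k \<in> lattice_pts) \<and> det (\<chi> i. h i) \<noteq> 0 \<and>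
        (\<Sum>k\<in>UNIV. \<tau> (h k)) * 2 powr pot (cone_mult h) \<le> K" if "h \<in> stellar g T" for h
  proof -
    consider "h \<in> T" | f' i where "h = f'(i := x)" "f' \<in> T" "S \<subseteq> range f'" "g (f' i) \<noteq> 0"
      using \<open>h \<in> stellar g T\<close> unfolding stellar_def S_def x_def by blast
    then show ?thesis
    proof cases
      case 1
      then show ?thesis using lat det bd by blast
    next
      case 2
      note c = child[OF 2(2-4), folded 2(1)]
      have "0 \<le> (\<Sum>k\<in>UNIV. \<tau> (f' k))" using \<tau>0[OF 2(2)] by (intro sum_nonneg) auto
      then have "(\<Sum>k\<in>UNIV. \<tau> (h k)) * 2 powr pot (cone_mult h) \<le>
        (2 powr t * (\<Sum>k\<in>UNIV. \<tau> (f' k))) * 2 powr (pot (cone_mult f') - t)"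
        using c by (intro mult_mono powr_mono) auto
      also have "\<dots> = (\<Sum>k\<in>UNIV. \<tau> (f' k)) * 2 powr pot (cone_mult f')"
        by (simp add: powr_diff)
      also have "\<dots> \<le> K" using bd[OF 2(2)] .
      finally show ?thesis using c by blast
    qed
  qed
  ultimately show ?thesis using cx unfolding bounded_complex_def by blast
qed

lemma refine_to_unimodular:
  fixes T :: "('n::finite \<Rightarrow> real ^ 'n) set"
  assumes "bounded_complex T C \<tau> K" "linear \<tau>" "\<And>y. y \<in> C \<Longrightarrow> 0 \<le> \<tau> y"
  shows "\<exists>T'. bounded_complex T' C \<tau> K \<and> (\<forall>f\<in>T'. cone_mult f = 1)"
  using assms(1)
proof (induction "complexity T" arbitrary: T rule: less_induct)
  case less
  show ?case
  proof (cases "\<forall>f\<in>T. cone_mult f = 1")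
    case False
    then obtain T' where "bounded_complex T' C \<tau> K" "complexity T' < complexity T"
      using refine_step[OF less.prems assms(2,3)] by blast
    then show ?thesis using less.hyps by blast
  qed (use less.prems in blast)
qed

section \<open>The resulting triangulation\<close>

lemma nonneg_span_eq_combination:
  fixes f :: "'n::finite \<Rightarrow> real ^ 'n"
  assumes "inj f"
  shows "nonneg_span f = combination ` weights {f}"
proof (intro equalityI subsetI)
  fix y assume "y \<in> nonneg_span f"
  then obtain a where a: "\<And>i. 0 \<le> a i" "y = (\<Sum>i\<in>UNIV. a i *\<^sub>R f i)"
    by (auto simp: nonneg_span_def)
  define b where "b = (\<lambda>w. if w \<in> range f then a (inv f w) else 0)"
  have bf: "b (f i) = a i" for i using assms by (simp add: b_def)
  have sb: "{w. b w \<noteq> 0} \<subseteq> range f" by (auto simp: b_def)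
  have "b \<in> weights {f}" using sb a(1) by (auto simp: weights_def b_def)
  moreover have "combination b = y" using combination_range[OF assms sb] a(2) bf by simp
  ultimately show "y \<in> combination ` weights {f}" by blast
next
  fix y assume "y \<in> combination ` weights {f}"
  then obtain a where a: "\<And>w. 0 \<le> a w" "{w. a w \<noteq> 0} \<subseteq> range f" "y = combination a"
    by (auto simp: weights_def)
  have "y = (\<Sum>i\<in>UNIV. a (f i) *\<^sub>R f i)" unfolding a(3) by (rule combination_range[OF assms a(2)])
  then show "y \<in> nonneg_span f"
    unfolding nonneg_span_def mem_Collect_eq using a(1) by (intro exI[of _ "\<lambda>i. a (f i)"]) simp
qed

lemma nonneg_span_bij_betw:
  fixes f :: "'n::finite \<Rightarrow> real ^ 'n"
  assumes "det (\<chi> i. f i) \<noteq> 0"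
  shows "bij_betw combination (weights {f}) (nonneg_span f)"
proof -
  have inj: "inj f" by (rule det_nonzero_inj[OF assms])
  have "inj_on combination (weights {f})"
  proof (rule inj_onI)
    fix a b assume a: "a \<in> weights {f}" and b: "b \<in> weights {f}" and comb: "combination a = combination b"
    have sa: "{w. a w \<noteq> 0} \<subseteq> range f" and sb: "{w. b w \<noteq> 0} \<subseteq> range f"
      using a b by (auto simp: weights_def)
    have "(\<Sum>i\<in>UNIV. (a (f i) - b (f i)) *\<^sub>R f i) = 0"
      using comb combination_range[OF inj sa] combination_range[OF inj sb]
      by (simp add: scaleR_left_diff_distrib sum_subtractf)
    then have "\<forall>i. a (f i) - b (f i) = 0" using assms[unfolded det_nonzero_iff, rule_format, of "\<lambda>i. a (f i) - b (f i)"] by blast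
    then have eq: "a (f i) = b (f i)" for i by simp
    show "a = b"
    proof
      fix w show "a w = b w"
      proof (cases "w \<in> range f")
        case True
        then show ?thesis using eq by auto
      next
        case False
        then have "a w = 0" "b w = 0" using sa sb by blast+
        then show ?thesis by simp
      qed
    qed
  qed
  then show ?thesis using nonneg_span_eq_combination[OF inj] by (simp add: bij_betw_def)
qed

lemma weights_UN: "weights T = (\<Union>f\<in>T. weights {f})"
  by (auto simp: weights_def)

lemma convex_nonneg_span: "convex (nonneg_span f)"
proof (rule convexI)
  fix x y and u v :: real
  assume "x \<in> nonneg_span f" "y \<in> nonneg_span f" and uv: "0 \<le> u" "0 \<le> v" "u + v = 1"
  then obtain a b where "\<And>i. 0 \<le> a i" "x = (\<Sum>i\<in>UNIV. a i *\<^sub>R f i)"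
    "\<And>i. 0 \<le> b i" "y = (\<Sum>i\<in>UNIV. b i *\<^sub>R f i)" by (auto simp: nonneg_span_def)
  then show "u *\<^sub>R x + v *\<^sub>R y \<in> nonneg_span f"
    unfolding nonneg_span_def using uv
    by (intro CollectI exI[of _ "\<lambda>i. u * a i + v * b i"])
       (simp add: scaleR_sum_right scaleR_add_left sum.distrib)
qed

text \<open>By uniqueness, x has the same weights in both cones. Strictly between y and z these are
  positive wherever the weights of y or z are, so y and z are supported on generators of h
  too.\<close>

lemma nonneg_span_Int_face:
  fixes T :: "('n::finite \<Rightarrow> real ^ 'n) set"
  assumes bij: "bij_betw combination (weights T) C" and inj: "\<And>f. f \<in> T \<Longrightarrow> inj f"
    and fh: "f \<in> T" "h \<in> T"
  shows "(nonneg_span f \<inter> nonneg_span h) face_of nonneg_span f"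
  unfolding face_of_def
proof (intro conjI ballI impI)
  show "convex (nonneg_span f \<inter> nonneg_span h)" by (intro convex_Int convex_nonneg_span)
next
  fix y z x
  assume y: "y \<in> nonneg_span f" and z: "z \<in> nonneg_span f"
    and x: "x \<in> nonneg_span f \<inter> nonneg_span h" and seg: "x \<in> open_segment y z"
  obtain a where a: "a \<in> weights {f}" "combination a = y"
    using y nonneg_span_eq_combination[OF inj[OF fh(1)]] by auto
  obtain b where b: "b \<in> weights {f}" "combination b = z"
    using z nonneg_span_eq_combination[OF inj[OF fh(1)]] by auto
  obtain c where c: "c \<in> weights {h}" "combination c = x"
    using x nonneg_span_eq_combination[OF inj[OF fh(2)]] by auto
  obtain u where u: "0 < u" "u < 1" "x = (1 - u) *\<^sub>R y + u *\<^sub>R z"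
    using seg by (auto simp: in_segment)
  have ab: "a w \<ge> 0" "b w \<ge> 0" for w using a b by (auto simp: weights_def)
  \<comment> \<open>The summand 0 gives the shape for using \<open>combination_add_scale\<close>
    twice.\<close>
  define e where "e = (\<lambda>w. (0 + (1 - u) * a w) + u * b w)"
  have e: "e w = (1 - u) * a w + u * b w" for w by (simp add: e_def)
  have eW: "e \<in> weights {f}"
  proof -
    have "w \<in> range f" if "e w \<noteq> 0" for w
    proof -
      have "a w \<noteq> 0 \<or> b w \<noteq> 0" using that by (auto simp: e)
      then show ?thesis using a(1) b(1) unfolding weights_def by blast
    qed
    then show ?thesis using ab u by (auto simp: weights_def e)
  qed
  have "combination e = x"
  proof -
    have fa: "finite {w. a w \<noteq> 0}" and fb: "finite {w. b w \<noteq> 0}"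
      using finite_support_weights a b by blast+
    have "combination (\<lambda>w. 0 + (1 - u) * a w) = combination (\<lambda>w. 0) + (1 - u) *\<^sub>R combination a"
      using fa by (intro combination_add_scale) auto
    moreover have "combination e = combination (\<lambda>w. 0 + (1 - u) * a w) + u *\<^sub>R combination b"
      unfolding e_def using fa fb u by (intro combination_add_scale) auto
    moreover have "combination (\<lambda>w. 0 :: real) = (0 :: real ^ 'n)" by (simp add: combination_def)
    ultimately show ?thesis using a b u by simp
  qed
  moreover have "e \<in> weights T" "c \<in> weights T" using eW c fh by (auto simp: weights_def)
  ultimately have "e = c" using bij c unfolding bij_betw_def inj_on_def by blast
  then have sub: "{w. e w \<noteq> 0} \<subseteq> range h" using c by (auto simp: weights_def)
  have "a w = 0 \<and> b w = 0" if "e w = 0" for w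
    using that ab[of w] u by (auto simp: e add_nonneg_eq_0_iff)
  then have "{w. a w \<noteq> 0} \<subseteq> range h" "{w. b w \<noteq> 0} \<subseteq> range h" using sub by blast+
  then have "a \<in> weights {h}" "b \<in> weights {h}" using ab by (auto simp: weights_def)
  then have "y \<in> nonneg_span h" "z \<in> nonneg_span h"
    using a b nonneg_span_eq_combination[OF inj[OF fh(2)]] by blast+
  then show "y \<in> nonneg_span f \<inter> nonneg_span h" "z \<in> nonneg_span f \<inter> nonneg_span h"
    using y z by auto
qed auto

lemma unimodular_simplicial_cone:
  fixes f :: "'n::finite \<Rightarrow> real ^ 'n"
  assumes lat: "\<And>i. f i \<in> lattice_pts" and m: "cone_mult f = 1"
  shows "simplicial_cone f (nonneg_span f)"
proof -
  have d1: "\<bar>det (\<chi> i. f i)\<bar> = 1" using real_cone_mult_lattice[of f] lat m by simp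
  then have d: "det (\<chi> i. f i) \<noteq> 0" by auto
  have inj: "inj f" by (rule det_nonzero_inj[OF d])
  have "primitive_vec (f i)" for i
    unfolding primitive_vec_def
  proof (intro conjI allI impI)
    show "f i \<noteq> 0"
    proof
      assume "f i = 0"
      then have "det (\<chi> i. f i) = 0" by (intro det_zero_row(2)[of i]) (simp add: row_def vec_eq_iff)
      then show False using d by simp
    qed
    fix k :: nat and y assume y: "y \<in> lattice_pts \<and> f i = real k *\<^sub>R y"
    \<comment> \<open>The multiplicity 1 of f is k times that of h, a natural number.\<close>
    define h where "h = f(i := y)"
    have "real k *\<^sub>R y = (\<Sum>j\<in>UNIV. (if j = i then real k else 0) *\<^sub>R h j)"
      by (simp add: h_def if_distrib[of "\<lambda>c. c *\<^sub>R _"] cong: if_cong)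
    from det_update[OF this, of i]
    have "det (\<chi> j. (h(i := real k *\<^sub>R y)) j) = real k * det (\<chi> j. h j)" by simp
    moreover have "h(i := real k *\<^sub>R y) = f" using y by (auto simp: h_def fun_eq_iff)
    ultimately have "det (\<chi> j. f j) = real k * det (\<chi> j. h j)" by metis
    moreover have "real (cone_mult h) = \<bar>det (\<chi> j. h j)\<bar>"
      by (rule real_cone_mult_lattice) (use y lat in \<open>auto simp: h_def\<close>)
    ultimately have "real (k * cone_mult h) = 1" using d1 by (simp add: abs_mult)
    then have "k * cone_mult h = 1" by (simp only: of_nat_eq_1_iff)
    then show "k = 1" by simp
  qed (rule lat)
  then show ?thesis using inj d det_nonzero_iff_independent[OF inj] by (simp add: simplicial_cone_def)
qed

section \<open>Hilbert bases of unimodular cones and the dilated simplex\<close>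

lemma Hilb_unimodular_subset:
  fixes f :: "'n::finite \<Rightarrow> real ^ 'n"
  assumes lat: "\<And>i. f i \<in> lattice_pts" and m: "cone_mult f = 1"
  shows "Hilb (nonneg_span f) \<subseteq> range f"
proof
  fix x assume x: "x \<in> Hilb (nonneg_span f)"
  then have x': "x \<in> nonneg_span f" "x \<in> lattice_pts" "x \<noteq> 0" by (auto simp: Hilb_def)
  obtain a where a: "\<And>i. 0 \<le> a i" "x = (\<Sum>i\<in>UNIV. a i *\<^sub>R f i)"
    using x'(1) by (auto simp: nonneg_span_def)
  have aint: "a i \<in> \<int>" for i
    using lattice_coordinates_integral[of f a i] lat x'(2) m unfolding a(2) by simp
  have "\<exists>i. a i \<noteq> 0"
  proof (rule ccontr)
    assume "\<not> ?thesis"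
    then have "x = 0" unfolding a(2) by simp
    then show False using x'(3) by simp
  qed
  then obtain i where "a i \<noteq> 0" by blast
  then have ai: "a i \<ge> 1" using aint[of i] a(1)[of i] by (auto elim!: Ints_cases)
  \<comment> \<open>Coordinates are integral, so one copy of f i can be split off; irreducibility of
    x forces the rest z to be 0.\<close>
  define b where "b = (\<lambda>j. if j = i then a j - 1 else a j)"
  define z where "z = (\<Sum>j\<in>UNIV. b j *\<^sub>R f j)"
  have "(\<Sum>j\<in>UNIV. (if j = i then 1 else 0) *\<^sub>R f j) = f i"
    by (simp add: if_distrib[of "\<lambda>c. c *\<^sub>R _"] cong: if_cong)
  moreover have "z = (\<Sum>j\<in>UNIV. a j *\<^sub>R f j - (if j = i then 1 else 0) *\<^sub>R f j)"
    unfolding z_def by (intro sum.cong) (auto simp: b_def scaleR_left_diff_distrib)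
  ultimately have xz: "x = f i + z" using a(2) by (simp add: sum_subtractf)
  have zD: "z \<in> nonneg_span f"
    unfolding nonneg_span_def z_def mem_Collect_eq using ai a(1)
    by (intro exI[of _ b]) (auto simp: b_def)
  have zL: "z \<in> lattice_pts"
    unfolding z_def using lat aint by (intro lattice_integral_combination) (auto simp: b_def)
  have "primitive_vec (f i)" using unimodular_simplicial_cone[of f] lat m by (simp add: simplicial_cone_def)
  then have f0: "f i \<noteq> 0" by (simp add: primitive_vec_def)
  have "f i = (\<Sum>j\<in>UNIV. (if j = i then 1 else 0) *\<^sub>R f j)"
    by (simp add: if_distrib[of "\<lambda>c. c *\<^sub>R _"] cong: if_cong)
  then have fD: "f i \<in> nonneg_span f"
    unfolding nonneg_span_def by (intro CollectI exI[of _ "\<lambda>j. if j = i then 1 else 0"]) auto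
  have "z = 0"
  proof (rule ccontr)
    assume "z \<noteq> 0"
    then have "f i \<in> nonneg_span f \<inter> lattice_pts - {0}" "z \<in> nonneg_span f \<inter> lattice_pts - {0}"
      using zD zL fD f0 lat by auto
    then show False using x xz unfolding Hilb_def by blast
  qed
  then show "x \<in> range f" using xz by simp
qed

text \<open>\<open>\<tau>\<close> is the coordinate sum, so y / B has coordinates of sum at most 1,
  and the vertex 0 of the simplex takes the remaining weight.\<close>

lemma in_scaled_Delta:
  fixes v :: "'n::finite \<Rightarrow> real ^ 'n"
  assumes v: "inj v" and \<tau>: "linear \<tau>" "\<And>i. \<tau> (v i) = 1"
    and y: "y \<in> nonneg_span v" "\<tau> y \<le> B" "B > 0"
  shows "y \<in> (\<lambda>x. B *\<^sub>R x) ` Delta v"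
proof -
  obtain a where a: "\<And>i. 0 \<le> a i" "y = (\<Sum>i\<in>UNIV. a i *\<^sub>R v i)"
    using y by (auto simp: nonneg_span_def)
  have "\<tau> y = (\<Sum>i\<in>UNIV. a i)" unfolding a(2) using \<tau> by (simp add: linear_sum linear_scale)
  then have s: "(\<Sum>i\<in>UNIV. a i) \<le> B" using y by simp
  define b where "b = (\<lambda>i. a i / B)"
  have b0: "b i \<ge> 0" for i using a y by (simp add: b_def)
  have b1: "(\<Sum>i\<in>UNIV. b i) \<le> 1" using s y by (simp add: b_def flip: sum_divide_distrib)
  have D: "convex (Delta v)" "0 \<in> Delta v" "\<And>i. v i \<in> Delta v"
    by (auto simp: Delta_def hull_inc)
  have "(\<Sum>i\<in>UNIV. b i *\<^sub>R v i) \<in> Delta v"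
  proof (cases "(\<Sum>i\<in>UNIV. b i) = 0")
    case True
    then have "b i = 0" for i using b0 by (simp add: sum_nonneg_eq_0_iff)
    then show ?thesis using D by simp
  next
    case False
    define s where "s = (\<Sum>i\<in>UNIV. b i)"
    have s0: "s > 0" using False b0 sum_nonneg[of UNIV b] by (simp add: s_def less_le)
    have "(\<Sum>i\<in>UNIV. (b i / s) *\<^sub>R v i) \<in> Delta v"
      using D b0 s0 by (intro convex_sum) (auto simp: s_def simp flip: sum_divide_distrib)
    then have "s *\<^sub>R (\<Sum>i\<in>UNIV. (b i / s) *\<^sub>R v i) + (1 - s) *\<^sub>R 0 \<in> Delta v"
      using D s0 b1 by (intro convexD) (auto simp: s_def)
    then show ?thesis using s0 by (simp add: scaleR_sum_right)
  qed
  moreover have "y = B *\<^sub>R (\<Sum>i\<in>UNIV. b i *\<^sub>R v i)"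
    using y a(2) by (simp add: scaleR_sum_right b_def)
  ultimately show ?thesis by blast
qed

lemma bound_eq_powr:
  assumes "n > 0"
  shows "real n * 4 powr phi n * (3 / 2) powr (1 / 2 * log 2 (real n) * (log 2 (real n) + 3)) =
    2 powr (5 * log 2 (real n) - 4 * real (eta n) + lam / 2 * (log 2 (real n) * (log 2 (real n) + 3)))"
proof -
  define L where "L = log 2 (real n)"
  have "real n = 2 powr L" using assms by (simp add: L_def)
  moreover have "4 powr phi n = 2 powr (2 * phi n)"
    using powr_powr[of 2 2 "phi n"] by simp
  moreover have "(3 / 2) powr (1 / 2 * L * (L + 3)) = 2 powr (lam * (1 / 2 * L * (L + 3)))"
    unfolding two_powr_lam[symmetric] powr_powr ..
  moreover have "L + 2 * phi n + lam * (1 / 2 * L * (L + 3)) =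
      5 * L - 4 * real (eta n) + lam / 2 * (L * (L + 3))"
    by (simp add: phi_def L_def algebra_simps)
  ultimately show ?thesis unfolding L_def[symmetric] by (metis powr_add)
qed

theorem theorem4p5:
  fixes v :: "'n::finite \<Rightarrow> real ^ 'n" and C :: "(real ^ 'n) set"
  assumes "CARD('n) \<ge> 2"
    and "simplicial_cone v C"
  shows "\<exists>\<D>. unimodular_triangulation \<D> C \<and>
    (\<forall>D\<in>\<D>. Hilb D \<subseteq>
      (\<lambda>x. (real CARD('n) ^ 2 / 4 * real (cone_mult v) * 4 powr phi (cone_mult v) *
             (3 / 2) powr (1 / 2 * log 2 (real (cone_mult v)) * (log 2 (real (cone_mult v)) + 3))) *\<^sub>R x)
        ` Delta v)"
proof -
  define d where "d = real CARD('n)"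
  define n where "n = cone_mult v"
  have d2: "d \<ge> 2" using assms(1) by (simp add: d_def)
  have inj: "inj v" and ind: "independent (range v)" and C: "C = nonneg_span v"
    and lat: "\<And>i. v i \<in> lattice_pts"
    using assms(2) by (auto simp: simplicial_cone_def primitive_vec_def)
  have det: "det (\<chi> i. v i) \<noteq> 0" using ind det_nonzero_iff_independent[OF inj] by simp
  have n0: "n > 0" unfolding n_def by (rule cone_mult_pos[OF lat det])
  obtain \<tau> :: "real ^ 'n \<Rightarrow> real" where \<tau>: "linear \<tau>" "\<And>i. \<tau> (v i) = 1"
    using linear_independent_extend[OF ind, of "\<lambda>_. 1"] by auto
  have \<tau>0: "0 \<le> \<tau> y" if "y \<in> C" for y
    using that \<tau> unfolding C nonneg_span_def by (auto simp: linear_sum linear_scale sum_nonneg)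
  have start: "bounded_complex {v} C \<tau> (d * 2 powr pot n)"
    using nonneg_span_bij_betw[OF det] lat det \<tau>(2) by (simp add: bounded_complex_def C d_def n_def)
  define E where "E = 5 * log 2 (real n) - 4 * real (eta n) + lam / 2 * (log 2 (real n) * (log 2 (real n) + 3))"
  define B where "B = d ^ 2 / 4 * real n * 4 powr phi n *
    (3 / 2) powr (1 / 2 * log 2 (real n) * (log 2 (real n) + 3))"
  have BE: "B = d ^ 2 / 4 * 2 powr E"
    unfolding B_def E_def bound_eq_powr[OF n0, symmetric] by simp
  have dd: "2 * d \<le> d ^ 2" using d2 by (simp add: power2_eq_square)
  have B0: "B > 0" using d2 by (simp add: BE)
  obtain T where T: "finite T" "bij_betw combination (weights T) C"
    "\<And>f i. f \<in> T \<Longrightarrow> f i \<in> lattice_pts" "\<And>f. f \<in> T \<Longrightarrow> cone_mult f = 1"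
    "\<And>f i. f \<in> T \<Longrightarrow> \<tau> (f i) \<le> B"
  \<comment> \<open>For n = 1 the bound B is d^2 / 4, which is below the length sum d if d < 4. So C
    itself is taken, whose generators have length 1.\<close>
  proof (cases "n = 1")
    case True
    have "0 \<le> E" using pot_le_budget[OF n0] True by (simp add: E_def)
    then have "1 * 1 \<le> d ^ 2 / 4 * 2 powr E"
      using dd d2 by (intro mult_mono ge_one_powr_ge_zero) auto
    then have "\<tau> (v i) \<le> B" for i using \<tau>(2) by (simp add: BE)
    then show ?thesis using that[of "{v}"] start lat True by (simp add: bounded_complex_def n_def)
  next
    case False
    obtain T where T: "bounded_complex T C \<tau> (d * 2 powr pot n)" "\<forall>f\<in>T. cone_mult f = 1"
      using refine_to_unimodular[OF start \<tau>(1) \<tau>0] by blast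
    have bij: "bij_betw combination (weights T) C" using T(1) by (simp add: bounded_complex_def)
    have "\<tau> (f i) \<le> B" if f: "f \<in> T" for f i
    proof -
      have "0 \<le> \<tau> (f j)" for j using \<tau>0 generator_in_carrier[OF bij f] by blast
      then have "\<tau> (f i) \<le> (\<Sum>j\<in>UNIV. \<tau> (f j))" by (intro member_le_sum) auto
      also have "\<dots> \<le> d * 2 powr pot n"
        using T f by (auto simp: bounded_complex_def)
      \<comment> \<open>The 1 saved in \<open>pot_le_budget\<close> turns d into d / 2, which is at
        most d^2 / 4 because d >= 2.\<close>
      also have "\<dots> \<le> d * 2 powr (E - 1)"
        using pot_le_budget[OF n0] False d2 by (intro mult_left_mono powr_mono) (auto simp: E_def)
      also have "\<dots> = (2 * d) / 4 * 2 powr E" by (simp add: powr_diff)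
      also have "\<dots> \<le> B" unfolding BE using dd by (intro mult_right_mono divide_right_mono) auto
      finally show ?thesis .
    qed
    then show ?thesis using that[of T] T by (simp add: bounded_complex_def)
  qed
  have cone: "simplicial_cone f (nonneg_span f)" if "f \<in> T" for f
    using unimodular_simplicial_cone[of f] T(3,4) that by blast
  then have injT: "inj f" if "f \<in> T" for f using that by (auto simp: simplicial_cone_def)
  have UT: "\<Union>(nonneg_span ` T) = C"
  proof -
    have "C = combination ` (\<Union>f\<in>T. weights {f})"
      using T(2) weights_UN[of T] by (simp add: bij_betw_def)
    also have "\<dots> = (\<Union>f\<in>T. nonneg_span f)"
      using nonneg_span_eq_combination[OF injT] by (simp add: image_UN)
    finally show ?thesis by simp
  qed
  have face: "(nonneg_span f \<inter> nonneg_span h) face_of nonneg_span f" if "f \<in> T" "h \<in> T" for f h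
    using nonneg_span_Int_face[OF T(2) injT that] .
  have "unimodular_triangulation (nonneg_span ` T) C"
    unfolding unimodular_triangulation_def cone_triangulation_def
  proof (intro conjI)
    show "\<forall>D\<in>nonneg_span ` T. \<forall>E\<in>nonneg_span ` T. (D \<inter> E) face_of D \<and> (D \<inter> E) face_of E"
      using face by (auto simp: Int_commute) (metis Int_commute)
    show "\<forall>D\<in>nonneg_span ` T. \<exists>w. simplicial_cone w D \<and> cone_mult w = 1"
      using cone T(4) by blast
  qed (use T(1) UT cone in auto)
  moreover have "Hilb D \<subseteq> (\<lambda>x. B *\<^sub>R x) ` Delta v" if D: "D \<in> nonneg_span ` T" for D
  proof
    fix x assume x: "x \<in> Hilb D"
    obtain f where f: "f \<in> T" "D = nonneg_span f" using D by blast
    have "Hilb D \<subseteq> range f" unfolding f(2) using T f by (intro Hilb_unimodular_subset) auto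
    then obtain i where i: "x = f i" using x by blast
    have "x \<in> C" unfolding i by (rule generator_in_carrier[OF T(2) f(1)])
    then show "x \<in> (\<lambda>x. B *\<^sub>R x) ` Delta v"
      using in_scaled_Delta[OF inj \<tau>, of x B] T(5)[OF f(1)] B0 by (simp add: C i)
  qed
  ultimately show ?thesis unfolding B_def n_def d_def by blast
qed

end
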